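(* Let $\mathcal L=\mathcal L_0+\mathcal L_1$ and $\mathcal N$ be as described in the context. (1) Suppose $s$ satisfies $\min\{0,-\ell+p\}\le s\le\max\{2p,p+\ell\}$. Then there exists a constant $c=c(\mathcal L,s)$ such that for every $\epsilon>0$, if $N>c\,\epsilon^{1/(p-k)}$, then no eigenvalue of $\mathcal L_0+\mathcal P_N\mathcal L_1$, restricted to $\operatorname{ran}\mathcal P_N$, lies in $\rho_\epsilon(\mathcal L;H^s(\mathbb T),H^{s-k}(\mathbb T))$. (2) Suppose $\lambda$ is an isolated eigenvalue of $\mathcal L$, define $\mathcal K(z)$ by $\mathrm{id}-\mathcal K(z)=\mathcal N(\mathcal L_0+\mathcal L_1-z\,\mathrm{id})$, and let $\delta=\delta(N,\lambda)=O(1)$ as $N\to\infty$ be such that, for some $0\le t\le k+\ell$, as $N\to\infty$, $$\max_{|z-\lambda|=\delta}\|(\mathrm{id}-\mathcal K(z))^{-1}\|_0\,N^{p-k}=o(1),$$ $$\delta\max_{|z-\lambda|=\delta}\|(\mathrm{id}-\mathcal K(z))^{-1}\|_0\max_{|z-\lambda|=\delta}\|(\mathrm{id}-\mathcal K(z))^{-1}\|_t\,N^{-t}(|\lambda|+1)^{\lceil t/(k-p)\rceil}=o(1).$$ Then there exists $N_0=N_0(\delta,\lambda)$ such that for all $N>N_0$ there is an eigenvalue $\lambda_N$ of $\mathcal L_0+\mathcal P_N\mathcal L_1$ with $|\lambda-\lambda_N|\le\delta$.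
   Context: $\mathbb T=[0,2\pi)$ with endpoints identified, $e_j(\theta)=e^{ij\theta}$, $u_j=\frac1{2\pi}\int_0^{2\pi}u\,\overline{e_j}\,d\theta$. For $s\in\mathbb R$, $H^s(\mathbb T)$ has norm $\|u\|_s^2=c_{|s|}\sum_j|u_j|^2\max\{1,|j|\}^{2s}$ (bi-infinite sequences when $s<0$), with fixed normalization constants $c_{|s|}>0$; operator norms on $H^s$ are also written $\|\cdot\|_s$. For $N\ge1$, $N_-=\lfloor N/2\rfloor$, $N_+=\lfloor(N-1)/2\rfloor$, $\mathcal P_Nu=\sum_{j=-N_-}^{N_+}u_je_j$. Fix integers $k\ge1$, $0\le p<k$, $0\le q\le k$, $\ell\ge1$, constants $c_q,\dots,c_k\in\mathbb C$ with $c_k\ne0$, $a_0,\dots,a_p\in H^\ell(\mathbb T)$; $\mathcal L_0u=\sum_{j=q}^kc_j\frac{d^ju}{d\theta^j}$, $\mathcal L_1u=\sum_{j=0}^pa_j\frac{d^ju}{d\theta^j}$, $\mathcal L=\mathcal L_0+\mathcal L_1$. Fix $\zeta\in\mathbb C$ with $\zeta\ne\sum_{j=q}^kc_j(im)^j$ for all $m\in\mathbb Z$, and $\mathcal N=(\mathcal L_0-\zeta\,\mathrm{id})^{-1}$. For Hilbert spaces $\mathbb V\subset\mathbb W$ (continuous inclusion) and bounded $\mathcal L:\mathbb V\to\mathbb W$, the $\epsilon$-pseudospectrum is $\sigma_\epsilon(\mathcal L;\mathbb V,\mathbb W)=\overline{\{z\in\mathbb C:\|(z\,\mathrm{id}-\mathcal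 L)^{-1}\|_{\mathbb W\to\mathbb V}>\epsilon^{-1}\}}$, with the convention that the norm is $\infty$ when $z\,\mathrm{id}-\mathcal L:\mathbb V\to\mathbb W$ has no bounded inverse; $\rho_\epsilon(\mathcal L;\mathbb V,\mathbb W)$ is its complement in $\mathbb C$. *)

theory Defs
  imports "HOL-Analysis.Analysis"
begin

text \<open>Elements of H^s(T) are represented by their (bi-infinite) Fourier coefficient
  sequences u_j, j in Z.\<close>
type_synonym fseq = "int \<Rightarrow> complex"

definition sob_wt :: "real \<Rightarrow> int \<Rightarrow> real" where
  "sob_wt s j = max 1 (real_of_int \<bar>j\<bar>) powr (2 * s)"

definition Hs :: "real \<Rightarrow> fseq set" where
  "Hs s = {u. (\<lambda>j. (cmod (u j))\<^sup>2 * sob_wt s j) summable_on UNIV}"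

text \<open>norm with normalisation constants cn |s| > 0\<close>
definition hnorm :: "(real \<Rightarrow> real) \<Rightarrow> real \<Rightarrow> fseq \<Rightarrow> real" where
  "hnorm cn s u = sqrt (cn \<bar>s\<bar> * (\<Sum>\<^sub>\<infinity>j. (cmod (u j))\<^sup>2 * sob_wt s j))"

text \<open>j-th derivative d^j/dtheta^j on Fourier coefficients\<close>
definition dth :: "nat \<Rightarrow> fseq \<Rightarrow> fseq" where
  "dth j u = (\<lambda>m. (\<i> * of_int m) ^ j * u m)"

text \<open>multiplication of functions = convolution of Fourier coefficients\<close>
definition cmul :: "fseq \<Rightarrow> fseq \<Rightarrow> fseq" where
  "cmul a v = (\<lambda>m. \<Sum>\<^sub>\<infinity>n. a (m - n) * v n)"

definition L0op :: "nat \<Rightarrow> nat \<Rightarrow> (nat \<Rightarrow> complex) \<Rightarrow> fseq \<Rightarrow> fseq" where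
  "L0op q k cc u = (\<lambda>m. \<Sum>j=q..k. cc j * dth j u m)"

definition L1op :: "nat \<Rightarrow> (nat \<Rightarrow> fseq) \<Rightarrow> fseq \<Rightarrow> fseq" where
  "L1op p a u = (\<lambda>m. \<Sum>j=0..p. cmul (a j) (dth j u) m)"

definition Lop :: "nat \<Rightarrow> nat \<Rightarrow> (nat \<Rightarrow> complex) \<Rightarrow> nat \<Rightarrow> (nat \<Rightarrow> fseq) \<Rightarrow> fseq \<Rightarrow> fseq" where
  "Lop q k cc p a u = (\<lambda>m. L0op q k cc u m + L1op p a u m)"

definition PN :: "nat \<Rightarrow> fseq \<Rightarrow> fseq" where
  "PN N u = (\<lambda>j. if - int (N div 2) \<le> j \<and> j \<le> int ((N - 1) div 2) then u j else 0)"

text \<open>Norm ||T^{-1}||_{W -> V}, infinity if T : V -> W has no bounded inverse.\<close>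
definition inv_opnorm :: "(fseq \<Rightarrow> fseq) \<Rightarrow> fseq set \<Rightarrow> (fseq \<Rightarrow> real)
    \<Rightarrow> fseq set \<Rightarrow> (fseq \<Rightarrow> real) \<Rightarrow> ereal" where
  "inv_opnorm T V nV W nW =
     (if bij_betw T V W then (SUP u \<in> V - {(\<lambda>_. 0)}. ereal (nV u / nW (T u))) else \<infinity>)"

definition shift_op :: "complex \<Rightarrow> (fseq \<Rightarrow> fseq) \<Rightarrow> fseq \<Rightarrow> fseq" where
  "shift_op z T u = (\<lambda>m. z * u m - T u m)"

definition pseudospec :: "(fseq \<Rightarrow> fseq) \<Rightarrow> fseq set \<Rightarrow> (fseq \<Rightarrow> real)
    \<Rightarrow> fseq set \<Rightarrow> (fseq \<Rightarrow> real) \<Rightarrow> real \<Rightarrow> complex set" where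
  "pseudospec T V nV W nW eps =
     closure {z. inv_opnorm (shift_op z T) V nV W nW > ereal (1 / eps)}"

definition pseudores :: "(fseq \<Rightarrow> fseq) \<Rightarrow> fseq set \<Rightarrow> (fseq \<Rightarrow> real)
    \<Rightarrow> fseq set \<Rightarrow> (fseq \<Rightarrow> real) \<Rightarrow> real \<Rightarrow> complex set" where
  "pseudores T V nV W nW eps = - pseudospec T V nV W nW eps"

definition spec_op :: "(fseq \<Rightarrow> fseq) \<Rightarrow> fseq set \<Rightarrow> (fseq \<Rightarrow> real)
    \<Rightarrow> fseq set \<Rightarrow> (fseq \<Rightarrow> real) \<Rightarrow> complex set" where
  "spec_op T V nV W nW = {z. inv_opnorm (shift_op z T) V nV W nW = \<infinity>}"

definition eig_trunc :: "nat \<Rightarrow> nat \<Rightarrow> (nat \<Rightarrow> complex) \<Rightarrow> nat \<Rightarrow> (nat \<Rightarrow> fseq)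
    \<Rightarrow> nat \<Rightarrow> complex \<Rightarrow> bool" where
  "eig_trunc q k cc p a N \<mu> \<longleftrightarrow>
     (\<exists>u. u \<noteq> (\<lambda>_. 0) \<and> PN N u = u \<and>
          (\<lambda>m. L0op q k cc u m + PN N (L1op p a u) m) = (\<lambda>m. \<mu> * u m))"

definition symb :: "nat \<Rightarrow> nat \<Rightarrow> (nat \<Rightarrow> complex) \<Rightarrow> int \<Rightarrow> complex" where
  "symb q k cc m = (\<Sum>j=q..k. cc j * (\<i> * of_int m) ^ j)"

text \<open>N = (L0 - zeta id)^{-1}\<close>
definition Nop :: "nat \<Rightarrow> nat \<Rightarrow> (nat \<Rightarrow> complex) \<Rightarrow> complex \<Rightarrow> fseq \<Rightarrow> fseq" where
  "Nop q k cc \<zeta> v = (\<lambda>m. v m / (symb q k cc m - \<zeta>))"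

definition IK :: "nat \<Rightarrow> nat \<Rightarrow> (nat \<Rightarrow> complex) \<Rightarrow> nat \<Rightarrow> (nat \<Rightarrow> fseq) \<Rightarrow> complex
    \<Rightarrow> complex \<Rightarrow> fseq \<Rightarrow> fseq" where
  "IK q k cc p a \<zeta> z u = Nop q k cc \<zeta> (\<lambda>m. Lop q k cc p a u m - z * u m)"

end

theory Submission
  imports Defs "HOL-Complex_Analysis.Conformal_Mappings" "Jordan_Normal_Form.Determinant"
begin

text \<open>
  Part (1): an eigenvector \<open>u\<close> of the truncated operator satisfies \<open>(\<mu> - L) u = - (id - P\<^sub>N) L\<^sub>1 u\<close>. For
  \<open>s \<le> p\<close> the right-hand side is \<open>O(N\<^bsup>p-k\<^esup> \<parallel>u\<parallel>\<^sub>s)\<close> in \<open>H\<^bsup>s-k\<^esup>\<close>, because \<open>L\<^sub>1\<close> maps \<open>H\<^sup>p\<close> to \<open>L\<^sup>2\<close> and \<open>u\<close> has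
  frequencies at most \<open>N\<close>; this bounds the resolvent norm at \<open>\<mu>\<close> from below by a multiple of \<open>N\<^bsup>k-p\<^esup>\<close>.
  For \<open>s > p\<close>, invertibility of \<open>\<mu> - L\<close> from \<open>H\<^sup>s\<close> to \<open>H\<^bsup>s-k\<^esup>\<close> forces the coefficients \<open>a\<^sub>j\<close> to lie in \<open>H\<^bsup>s-k\<^esup>\<close>.
  Finitely many steps of a high-frequency parametrix above \<open>\<kappa> \<approx> |\<mu>|\<^bsup>1/k\<^esup>\<close> then replace \<open>u\<close> by some \<open>w\<close> whose
  residual is \<open>O(\<kappa>\<^bsup>s-p\<^esup> N\<^bsup>p-k\<^esup> \<parallel>u\<parallel>\<^sub>p)\<close> in \<open>H\<^bsup>s-k\<^esup>\<close>, while \<open>w\<close> is concentrated on frequencies of order at least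
  \<open>\<kappa>\<close>, so that \<open>\<parallel>w\<parallel>\<^sub>s\<close> is at least a multiple of \<open>\<kappa>\<^bsup>s-p\<^esup> \<parallel>u\<parallel>\<^sub>p\<close>.

  Part (2): let \<open>L\<^sub>N\<close> be the truncated operator and \<open>L \<phi> = \<lambda> \<phi>\<close>. Then \<open>(\<lambda> - L\<^sub>N) P\<^sub>N \<phi> = g\<close> with
  \<open>g = P\<^sub>N L\<^sub>1 (id - P\<^sub>N) \<phi> = O(N\<^bsup>p-k\<^esup>)\<close>. If \<open>L\<^sub>N\<close> had no eigenvalue in the disc of radius \<open>\<delta>\<close> about \<open>\<lambda>\<close>, then
  \<open>y(z) = (z - L\<^sub>N)\<^sup>-\<^sup>1 g\<close> would be holomorphic there with \<open>y(\<lambda>) = P\<^sub>N \<phi>\<close>. On the circle the bound on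
  \<open>(id - K(z))\<^sup>-\<^sup>1\<close> makes \<open>y(z)\<close> arbitrarily small, which contradicts the maximum modulus principle.
\<close>

section \<open>Weighted sequence spaces\<close>

text \<open>The base of the Sobolev weight: \<open>sob_wt s j\<close> is the square of
  \<open>br j powr s\<close>, so every norm below is an l^2 norm of weighted moduli.\<close>

definition br :: "int \<Rightarrow> real" where
  "br j = max 1 (real_of_int \<bar>j\<bar>)"

text \<open>Estimates are made without the factor \<open>cn\<close>; it returns through
  \<open>hnorm_eq_hn\<close> only where inverse norms are compared.\<close>

definition hn :: "real \<Rightarrow> fseq \<Rightarrow> real" where
  "hn s u = sqrt (\<Sum>\<^sub>\<infinity>j. (cmod (u j))\<^sup>2 * sob_wt s j)"

lemma hnorm_eq_hn: "hnorm cn s u = sqrt (cn \<bar>s\<bar>) * hn s u"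
  by (simp add: hnorm_def hn_def real_sqrt_mult)

lemma br_ge_1 [simp]: "1 \<le> br j"
  by (simp add: br_def)

lemma br_pos [simp]: "0 < br j"
  using br_ge_1[of j] by linarith

lemma br_nonneg [simp]: "0 \<le> br j"
  using br_pos[of j] by linarith

lemma br_neq_0 [simp]: "br j \<noteq> 0"
  using br_pos[of j] by linarith

lemma br_triangle: "br m \<le> br (m - n) + br n"
  by (auto simp: br_def)

lemma sob_term_eq: "(cmod (u j))\<^sup>2 * sob_wt s j = (cmod (u j) * br j powr s)\<^sup>2"
  by (simp add: sob_wt_def br_def power_mult_distrib power2_eq_square powr_add[symmetric])

lemma hn_nonneg [simp]: "0 \<le> hn s u"
  by (simp add: hn_def infsum_nonneg sob_term_eq)

lemma L2_set_le_hn: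
  assumes "u \<in> Hs s"
  shows "L2_set (\<lambda>j. cmod (u j) * br j powr s) F \<le> hn s u"
proof (cases "finite F")
  case True
  have "(\<Sum>j\<in>F. (cmod (u j))\<^sup>2 * sob_wt s j) \<le> (\<Sum>\<^sub>\<infinity>j. (cmod (u j))\<^sup>2 * sob_wt s j)"
    using assms True by (intro finite_sum_le_infsum) (auto simp: Hs_def sob_term_eq)
  then show ?thesis
    unfolding L2_set_def hn_def sob_term_eq by simp
qed simp

text \<open>Uniform bounds on finite sections give summability and the norm bound at once. Estimates
  can thus be run with \<open>L2_set\<close> over finite sets, where Minkowski and Cauchy-Schwarz
  apply directly.\<close>

lemma Hs_bound:
  assumes "\<And>F. finite F \<Longrightarrow> L2_set (\<lambda>j. cmod (u j) * br j powr s) F \<le> B"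
  shows "u \<in> Hs s" and "hn s u \<le> B"
proof -
  have B: "0 \<le> B"
    using assms[of "{}"] by simp
  have le: "(\<Sum>j\<in>F. (cmod (u j))\<^sup>2 * sob_wt s j) \<le> B\<^sup>2" if "finite F" for F
    using assms[OF that] B unfolding L2_set_def sob_term_eq
    by (simp add: sum_nonneg real_le_lsqrt sqrt_le_D)
  have sm: "(\<lambda>j. (cmod (u j))\<^sup>2 * sob_wt s j) summable_on UNIV"
    using le by (intro nonneg_bdd_above_summable_on bdd_aboveI[of _ "B\<^sup>2"]) (auto simp: sob_term_eq)
  then show "u \<in> Hs s"
    by (simp add: Hs_def)
  have "(\<Sum>\<^sub>\<infinity>j. (cmod (u j))\<^sup>2 * sob_wt s j) \<le> B\<^sup>2"
    using le sm by (intro infsum_le_finite_sums) auto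
  then show "hn s u \<le> B"
    using B by (simp add: hn_def real_le_lsqrt)
qed

text \<open>Fourier multipliers and frequency cut-offs act diagonally, so all their norm estimates
  reduce to this pointwise domination.\<close>

lemma Hs_compare:
  assumes "u \<in> Hs s" and "0 \<le> c"
    and le: "\<And>j. cmod (v j) * br j powr t \<le> c * (cmod (u j) * br j powr s)"
  shows "v \<in> Hs t" and "hn t v \<le> c * hn s u"
proof -
  have *: "L2_set (\<lambda>j. cmod (v j) * br j powr t) F \<le> c * hn s u" if "finite F" for F
  proof -
    have "L2_set (\<lambda>j. cmod (v j) * br j powr t) F
        \<le> L2_set (\<lambda>j. c * (cmod (u j) * br j powr s)) F"
      by (intro L2_set_mono le) auto
    also have "\<dots> = c * L2_set (\<lambda>j. cmod (u j) * br j powr s) F"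
      using assms(2) by (simp add: L2_set_right_distrib)
    also have "\<dots> \<le> c * hn s u"
      by (intro mult_left_mono L2_set_le_hn assms)
    finally show ?thesis .
  qed
  show "v \<in> Hs t" "hn t v \<le> c * hn s u"
    using Hs_bound[of v t, OF *] by auto
qed

lemma Hs_mono:
  assumes "u \<in> Hs s" "t \<le> s"
  shows "u \<in> Hs t" "hn t u \<le> hn s u"
proof -
  have "cmod (u j) * br j powr t \<le> 1 * (cmod (u j) * br j powr s)" for j
    using assms(2) by (auto intro!: mult_left_mono powr_mono)
  from Hs_compare[OF assms(1) zero_le_one this] show "u \<in> Hs t" "hn t u \<le> hn s u"
    by auto
qed

lemma Hs_cmult:
  assumes "u \<in> Hs s"
  shows "(\<lambda>m. c * u m) \<in> Hs s" "hn s (\<lambda>m. c * u m) \<le> cmod c * hn s u"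
  using Hs_compare[OF assms, of "cmod c" "\<lambda>m. c * u m" s] by (auto simp: norm_mult)

lemma Hs_add:
  assumes "u \<in> Hs s" "v \<in> Hs s"
  shows "(\<lambda>m. u m + v m) \<in> Hs s" "hn s (\<lambda>m. u m + v m) \<le> hn s u + hn s v"
proof -
  have *: "L2_set (\<lambda>j. cmod (u j + v j) * br j powr s) F \<le> hn s u + hn s v" if "finite F" for F
  proof -
    have "L2_set (\<lambda>j. cmod (u j + v j) * br j powr s) F
        \<le> L2_set (\<lambda>j. cmod (u j) * br j powr s + cmod (v j) * br j powr s) F"
      by (intro L2_set_mono) (auto simp flip: distrib_right intro!: mult_right_mono norm_triangle_ineq)
    also have "\<dots> \<le> L2_set (\<lambda>j. cmod (u j) * br j powr s) F + L2_set (\<lambda>j. cmod (v j) * br j powr s) F"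
      by (rule L2_set_triangle_ineq)
    also have "\<dots> \<le> hn s u + hn s v"
      by (intro add_mono L2_set_le_hn assms)
    finally show ?thesis .
  qed
  show "(\<lambda>m. u m + v m) \<in> Hs s" "hn s (\<lambda>m. u m + v m) \<le> hn s u + hn s v"
    using Hs_bound[of "\<lambda>m. u m + v m" s, OF *] by auto
qed

lemma Hs_diff:
  assumes "u \<in> Hs s" "v \<in> Hs s"
  shows "(\<lambda>m. u m - v m) \<in> Hs s" "hn s (\<lambda>m. u m - v m) \<le> hn s u + hn s v"
  using Hs_add[OF assms(1) Hs_cmult(1)[OF assms(2), of "-1"]] Hs_cmult(2)[OF assms(2), of "-1"]
  by auto

lemma Hs_zero [simp]: "(\<lambda>_. 0) \<in> Hs s" "hn s (\<lambda>_. 0) = 0"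
  by (simp_all add: Hs_def hn_def)

lemma Hs_sum:
  assumes "\<And>i. i \<in> I \<Longrightarrow> f i \<in> Hs s" "finite I"
  shows "(\<lambda>m. \<Sum>i\<in>I. f i m) \<in> Hs s \<and> hn s (\<lambda>m. \<Sum>i\<in>I. f i m) \<le> (\<Sum>i\<in>I. hn s (f i))"
  using assms(2,1)
proof (induction I rule: finite_induct)
  case (insert i I)
  then show ?case
    using Hs_add[of "f i" s "\<lambda>m. \<Sum>i\<in>I. f i m"] by (auto intro: order_trans)
qed simp

lemma coeff_le_hn:
  assumes "u \<in> Hs s"
  shows "cmod (u j) * br j powr s \<le> hn s u"
  using L2_set_le_hn[OF assms, of "{j}"] by simp

lemma hn_pos:
  assumes "u \<in> Hs s" "u \<noteq> (\<lambda>_. 0)"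
  shows "0 < hn s u"
proof -
  obtain j where "u j \<noteq> 0"
    using assms(2) by auto
  then have "0 < cmod (u j) * br j powr s"
    by simp
  then show ?thesis
    using coeff_le_hn[OF assms(1), of j] by linarith
qed

section \<open>Young's inequality and products in Sobolev spaces\<close>

lemma L2_set_sum_le: "L2_set (\<lambda>m. \<Sum>l\<in>G. f l m) F \<le> (\<Sum>l\<in>G. L2_set (f l) F)"
proof (induction G rule: infinite_finite_induct)
  case (insert x G)
  then show ?case
    using L2_set_triangle_ineq[of "f x" "\<lambda>m. \<Sum>l\<in>G. f l m" F] by simp
qed (simp_all add: L2_set_0')

lemma bij_diff_int: "bij_betw (\<lambda>n. m - n) UNIV (UNIV :: int set)"
  by (rule bij_betwI[where g = "\<lambda>n. m - n"]) auto

text \<open>Convolution with an l^1 sequence is bounded on l^2. For a finite partial sum over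
  \<open>n\<close> this is Minkowski's inequality and translation invariance of the l^2 norm; the
  bound survives the limit over finite sets. Both placements of the l^1 factor are provided.\<close>

lemma young_convolution:
  fixes \<alpha> \<beta> :: "int \<Rightarrow> real"
  assumes \<alpha>: "\<And>n. 0 \<le> \<alpha> n" "\<alpha> summable_on UNIV" and \<beta>: "\<And>n. 0 \<le> \<beta> n"
    and B: "\<And>F. finite F \<Longrightarrow> L2_set \<beta> F \<le> B"
  shows "(\<lambda>n. \<alpha> (m - n) * \<beta> n) summable_on UNIV"
    and "(\<lambda>n. \<beta> (m - n) * \<alpha> n) summable_on UNIV"
    and "finite F \<Longrightarrow> L2_set (\<lambda>m. \<Sum>\<^sub>\<infinity>n. \<alpha> (m - n) * \<beta> n) F \<le> infsum \<alpha> UNIV * B"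
    and "finite F \<Longrightarrow> L2_set (\<lambda>m. \<Sum>\<^sub>\<infinity>n. \<beta> (m - n) * \<alpha> n) F \<le> infsum \<alpha> UNIV * B"
proof -
  have \<beta>_le: "\<beta> n \<le> B" for n
    using B[of "{n}"] \<beta>[of n] by simp
  have sm: "(\<lambda>n. \<beta> (m - n) * \<alpha> n) summable_on UNIV" for m
  proof (rule summable_on_comparison_test)
    show "(\<lambda>n. B * \<alpha> n) summable_on UNIV"
      using \<alpha>(2) by (rule summable_on_cmult_right)
  qed (auto intro!: mult_right_mono \<beta>_le simp: \<alpha> \<beta>)
  show "(\<lambda>n. \<beta> (m - n) * \<alpha> n) summable_on UNIV"
    by (rule sm)
  show "(\<lambda>n. \<alpha> (m - n) * \<beta> n) summable_on UNIV"
    using sm[of m] summable_on_reindex_bij_betw[OF bij_diff_int[of m], of "\<lambda>n. \<beta> (m - n) * \<alpha> n"]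
    by (simp add: mult.commute)
  have swap: "(\<Sum>\<^sub>\<infinity>n. \<alpha> (m - n) * \<beta> n) = (\<Sum>\<^sub>\<infinity>n. \<beta> (m - n) * \<alpha> n)" for m
    using infsum_reindex_bij_betw[OF bij_diff_int[of m], of "\<lambda>n. \<beta> (m - n) * \<alpha> n"]
    by (simp add: mult.commute)
  show *: "L2_set (\<lambda>m. \<Sum>\<^sub>\<infinity>n. \<beta> (m - n) * \<alpha> n) F \<le> infsum \<alpha> UNIV * B" if F: "finite F" for F
  proof (rule tendsto_upperbound)
    show "((\<lambda>G. L2_set (\<lambda>m. \<Sum>n\<in>G. \<beta> (m - n) * \<alpha> n) F) \<longlongrightarrow>
        L2_set (\<lambda>m. \<Sum>\<^sub>\<infinity>n. \<beta> (m - n) * \<alpha> n) F) (finite_subsets_at_top UNIV)"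
      unfolding L2_set_def by (intro tendsto_intros infsum_tendsto sm)
    show "\<forall>\<^sub>F G in finite_subsets_at_top UNIV. L2_set (\<lambda>m. \<Sum>n\<in>G. \<beta> (m - n) * \<alpha> n) F \<le> infsum \<alpha> UNIV * B"
    proof (rule eventually_finite_subsets_at_top_weakI)
      fix G :: "int set"
      assume G: "finite G"
      have sh: "L2_set (\<lambda>m. \<beta> (m - n)) F \<le> B" for n
      proof -
        have "L2_set (\<lambda>m. \<beta> (m - n)) F = L2_set \<beta> ((\<lambda>m. m - n) ` F)"
          unfolding L2_set_def by (subst sum.reindex) (auto simp: inj_on_def)
        then show ?thesis
          using B F by simp
      qed
      have "L2_set (\<lambda>m. \<Sum>n\<in>G. \<beta> (m - n) * \<alpha> n) F \<le> (\<Sum>n\<in>G. L2_set (\<lambda>m. \<beta> (m - n) * \<alpha> n) F)"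
        by (rule L2_set_sum_le)
      also have "\<dots> = (\<Sum>n\<in>G. L2_set (\<lambda>m. \<beta> (m - n)) F * \<alpha> n)"
        using \<alpha>(1) by (simp add: L2_set_left_distrib)
      also have "\<dots> \<le> (\<Sum>n\<in>G. B * \<alpha> n)"
        by (intro sum_mono mult_right_mono sh \<alpha>(1))
      also have "\<dots> = B * sum \<alpha> G"
        by (simp add: sum_distrib_left)
      also have "\<dots> \<le> B * infsum \<alpha> UNIV"
        using \<alpha> B[of "{}"] G by (intro mult_left_mono finite_sum_le_infsum) auto
      finally show "L2_set (\<lambda>m. \<Sum>n\<in>G. \<beta> (m - n) * \<alpha> n) F \<le> infsum \<alpha> UNIV * B"
        by (simp add: mult.commute)
    qed
  qed simp
  show "L2_set (\<lambda>m. \<Sum>\<^sub>\<infinity>n. \<alpha> (m - n) * \<beta> n) F \<le> infsum \<alpha> UNIV * B" if "finite F"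
    using *[OF that] by (simp add: swap)
qed

lemma summable_br_powr: "(\<lambda>j. (br j powr (-1))\<^sup>2) summable_on UNIV"
proof -
  have nat: "(\<lambda>n::nat. (br (int n) powr (-1))\<^sup>2) summable_on UNIV"
  proof (rule norm_summable_imp_summable_on, rule summable_comparison_test_ev)
    show "summable (\<lambda>n::nat. 1 / real n ^ 2)"
      using inverse_power_summable[of 2, where 'a = real] by (simp add: divide_inverse)
    show "\<forall>\<^sub>F n in sequentially. norm (norm ((br (int n) powr (-1))\<^sup>2)) \<le> 1 / real n ^ 2"
      using eventually_gt_at_top[of "0::nat"]
      by eventually_elim (auto simp: br_def powr_minus_divide power_divide max_def)
  qed
  have "(\<lambda>j. (br j powr (-1))\<^sup>2) summable_on range int"
    using nat by (subst summable_on_reindex) (auto simp: inj_def o_def)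
  moreover have "(\<lambda>j. (br j powr (-1))\<^sup>2) summable_on range (\<lambda>n. - int n)"
    using nat by (subst summable_on_reindex) (auto simp: inj_def o_def br_def)
  moreover have "range int \<union> range (\<lambda>n. - int n) = UNIV"
    by (metis (no_types, lifting) UNIV_eq_I UnI1 UnI2 int_cases2 rangeI)
  ultimately show ?thesis
    by (metis summable_on_union)
qed

definition br_const :: real where
  "br_const = sqrt (\<Sum>\<^sub>\<infinity>j. (br j powr (-1))\<^sup>2)"

lemma br_const_nonneg [simp]: "0 \<le> br_const"
  by (simp add: br_const_def infsum_nonneg)

text \<open>Cauchy-Schwarz against the square summable sequence
  \<open>br n powr (-1)\<close>.\<close>

lemma Hs_abs_summable:
  assumes "u \<in> Hs s" "1 \<le> s"
  shows "(\<lambda>n. cmod (u n)) summable_on UNIV" "(\<Sum>\<^sub>\<infinity>n. cmod (u n)) \<le> br_const * hn s u"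
proof -
  have u1: "u \<in> Hs 1" "hn 1 u \<le> hn s u"
    using Hs_mono assms by auto
  have le: "(\<Sum>n\<in>F. cmod (u n)) \<le> br_const * hn s u" if "finite F" for F
  proof -
    have "(\<Sum>n\<in>F. cmod (u n)) = (\<Sum>n\<in>F. \<bar>br n powr (-1)\<bar> * \<bar>cmod (u n) * br n powr 1\<bar>)"
      by (intro sum.cong) (auto simp: powr_minus)
    also have "\<dots> \<le> L2_set (\<lambda>n. br n powr (-1)) F * L2_set (\<lambda>n. cmod (u n) * br n powr 1) F"
      by (rule L2_set_mult_ineq)
    also have "\<dots> \<le> br_const * hn s u"
    proof (intro mult_mono)
      have "(\<Sum>n\<in>F. (br n powr (-1))\<^sup>2) \<le> (\<Sum>\<^sub>\<infinity>j. (br j powr (-1))\<^sup>2)"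
        using summable_br_powr that by (intro finite_sum_le_infsum) auto
      then show "L2_set (\<lambda>n. br n powr (-1)) F \<le> br_const"
        by (simp add: L2_set_def br_const_def)
      show "L2_set (\<lambda>n. cmod (u n) * br n powr 1) F \<le> hn s u"
        using L2_set_le_hn[OF u1(1), of F] u1(2) by linarith
    qed auto
    finally show ?thesis .
  qed
  show "(\<lambda>n. cmod (u n)) summable_on UNIV"
    using le by (intro nonneg_bdd_above_summable_on bdd_aboveI[of _ "br_const * hn s u"]) auto
  then show "(\<Sum>\<^sub>\<infinity>n. cmod (u n)) \<le> br_const * hn s u"
    using le by (intro infsum_le_finite_sums) auto
qed

lemma cmul_summable:
  assumes "a \<in> Hs 1" "v \<in> Hs 0"
  shows "(\<lambda>n. cmod (a (m - n)) * cmod (v n)) summable_on UNIV"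
    and "(\<lambda>n. a (m - n) * v n) summable_on UNIV"
    and "cmod (cmul a v m) \<le> (\<Sum>\<^sub>\<infinity>n. cmod (a (m - n)) * cmod (v n))"
proof -
  show s: "(\<lambda>n. cmod (a (m - n)) * cmod (v n)) summable_on UNIV"
    using L2_set_le_hn[OF assms(2)]
    by (intro young_convolution(1)[where B = "hn 0 v"] Hs_abs_summable[OF assms(1)]) auto
  then have abs: "(\<lambda>n. norm (a (m - n) * v n)) summable_on UNIV"
    by (simp add: norm_mult)
  then show "(\<lambda>n. a (m - n) * v n) summable_on UNIV"
    by (rule abs_summable_summable)
  show "cmod (cmul a v m) \<le> (\<Sum>\<^sub>\<infinity>n. cmod (a (m - n)) * cmod (v n))"
    using norm_infsum_bound[OF abs] by (simp add: cmul_def norm_mult)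
qed

lemma cmul_Hs_0:
  assumes "a \<in> Hs 1" "v \<in> Hs 0"
  shows "cmul a v \<in> Hs 0" and "hn 0 (cmul a v) \<le> br_const * hn 1 a * hn 0 v"
proof -
  have *: "L2_set (\<lambda>m. cmod (cmul a v m) * br m powr 0) F \<le> br_const * hn 1 a * hn 0 v"
    if "finite F" for F
  proof -
    have "L2_set (\<lambda>m. cmod (cmul a v m) * br m powr 0) F
        \<le> L2_set (\<lambda>m. \<Sum>\<^sub>\<infinity>n. cmod (a (m - n)) * cmod (v n)) F"
      using cmul_summable(3)[OF assms] by (intro L2_set_mono) auto
    also have "\<dots> \<le> (\<Sum>\<^sub>\<infinity>n. cmod (a n)) * hn 0 v"
      using L2_set_le_hn[OF assms(2)] that
      by (intro young_convolution(3) Hs_abs_summable[OF assms(1)]) auto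
    also have "\<dots> \<le> br_const * hn 1 a * hn 0 v"
      by (intro mult_right_mono Hs_abs_summable[OF assms(1)]) auto
    finally show ?thesis .
  qed
  show "cmul a v \<in> Hs 0" "hn 0 (cmul a v) \<le> br_const * hn 1 a * hn 0 v"
    using Hs_bound[of "cmul a v" 0, OF *] by auto
qed

text \<open>A Peetre-type inequality: the weight at \<open>m\<close> is controlled by the larger of
  the two weights, each of which is below their sum.\<close>

lemma br_powr_triangle:
  assumes "0 \<le> s"
  shows "br m powr s \<le> 2 powr s * (br (m - n) powr s + br n powr s)"
proof -
  have "br m powr s \<le> (2 * max (br (m - n)) (br n)) powr s"
    using br_triangle[of m n] assms by (intro powr_mono2) (auto simp: less_imp_le)
  also have "\<dots> = 2 powr s * max (br (m - n)) (br n) powr s"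
    by (intro powr_mult)
  also have "\<dots> \<le> 2 powr s * (br (m - n) powr s + br n powr s)"
    by (intro mult_left_mono) (auto simp: max_def)
  finally show ?thesis .
qed

text \<open>The algebra property: \<open>br_powr_triangle\<close> moves the weight onto one factor
  at a time, and Young's inequality treats the two resulting convolutions with the unweighted factor
  in l^1.\<close>

lemma cmul_Hs:
  assumes "1 \<le> s" "a \<in> Hs s" "v \<in> Hs s"
  shows "cmul a v \<in> Hs s" and "hn s (cmul a v) \<le> 2 powr s * (2 * br_const * hn s a) * hn s v"
proof -
  have a1: "a \<in> Hs 1" and v0: "v \<in> Hs 0"
    using Hs_mono assms by auto
  define \<alpha> where "\<alpha> = (\<lambda>n. cmod (a n) * br n powr s)"
  define \<beta> where "\<beta> = (\<lambda>n. cmod (v n) * br n powr s)"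
  have \<alpha>: "L2_set \<alpha> F \<le> hn s a" and \<beta>: "L2_set \<beta> F \<le> hn s v" for F
    using L2_set_le_hn assms by (auto simp: \<alpha>_def \<beta>_def)
  have nn: "0 \<le> \<alpha> n" "0 \<le> \<beta> n" for n
    by (auto simp: \<alpha>_def \<beta>_def)
  note av = Hs_abs_summable[OF assms(2,1)] and vv = Hs_abs_summable[OF assms(3,1)]
  define p where "p m = (\<Sum>\<^sub>\<infinity>n. \<alpha> (m - n) * cmod (v n))" for m
  define q where "q m = (\<Sum>\<^sub>\<infinity>n. cmod (a (m - n)) * \<beta> n)" for m
  have ps: "(\<lambda>n. \<alpha> (m - n) * cmod (v n)) summable_on UNIV" for m
    using young_convolution(2)[of "\<lambda>n. cmod (v n)" \<alpha>] vv \<alpha> nn by auto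
  have qs: "(\<lambda>n. cmod (a (m - n)) * \<beta> n) summable_on UNIV" for m
    using young_convolution(1)[of "\<lambda>n. cmod (a n)" \<beta>] av \<beta> nn by auto
  have pq: "cmod (cmul a v m) * br m powr s \<le> 2 powr s * (p m + q m)" for m
  proof -
    have "cmod (cmul a v m) * br m powr s \<le> (\<Sum>\<^sub>\<infinity>n. cmod (a (m - n)) * cmod (v n)) * br m powr s"
      by (intro mult_right_mono cmul_summable(3) a1 v0) auto
    also have "\<dots> = (\<Sum>\<^sub>\<infinity>n. cmod (a (m - n)) * cmod (v n) * br m powr s)"
      using cmul_summable(1)[OF a1 v0] by (simp add: infsum_cmult_left)
    also have "\<dots> \<le> (\<Sum>\<^sub>\<infinity>n. 2 powr s * (\<alpha> (m - n) * cmod (v n) + cmod (a (m - n)) * \<beta> n))"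
    proof (rule infsum_mono)
      show "(\<lambda>n. cmod (a (m - n)) * cmod (v n) * br m powr s) summable_on UNIV"
        by (intro summable_on_cmult_left cmul_summable(1) a1 v0)
      show "(\<lambda>n. 2 powr s * (\<alpha> (m - n) * cmod (v n) + cmod (a (m - n)) * \<beta> n)) summable_on UNIV"
        by (intro summable_on_cmult_right summable_on_add ps qs)
      fix n
      have "cmod (a (m - n)) * cmod (v n) * br m powr s
          \<le> cmod (a (m - n)) * cmod (v n) * (2 powr s * (br (m - n) powr s + br n powr s))"
        using assms by (intro mult_left_mono br_powr_triangle) auto
      then show "cmod (a (m - n)) * cmod (v n) * br m powr s
          \<le> 2 powr s * (\<alpha> (m - n) * cmod (v n) + cmod (a (m - n)) * \<beta> n)"
        by (simp add: \<alpha>_def \<beta>_def algebra_simps)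
    qed
    also have "\<dots> = 2 powr s * (p m + q m)"
      unfolding p_def q_def by (simp add: infsum_cmult_right infsum_add ps qs summable_on_add)
    finally show ?thesis .
  qed
  have *: "L2_set (\<lambda>m. cmod (cmul a v m) * br m powr s) F \<le> 2 powr s * (2 * br_const * hn s a) * hn s v"
    if "finite F" for F
  proof -
    have "L2_set (\<lambda>m. cmod (cmul a v m) * br m powr s) F \<le> L2_set (\<lambda>m. 2 powr s * (p m + q m)) F"
      using pq by (intro L2_set_mono) auto
    also have "\<dots> = 2 powr s * L2_set (\<lambda>m. p m + q m) F"
      by (simp add: L2_set_right_distrib)
    also have "\<dots> \<le> 2 powr s * (L2_set p F + L2_set q F)"
      by (intro mult_left_mono L2_set_triangle_ineq) auto
    also have "\<dots> \<le> 2 powr s * ((br_const * hn s v) * hn s a + (br_const * hn s a) * hn s v)"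
    proof (intro mult_left_mono add_mono)
      have "L2_set p F \<le> (\<Sum>\<^sub>\<infinity>n. cmod (v n)) * hn s a"
        unfolding p_def using that vv \<alpha> nn by (intro young_convolution(4)) auto
      also have "\<dots> \<le> (br_const * hn s v) * hn s a"
        using vv by (intro mult_right_mono) auto
      finally show "L2_set p F \<le> (br_const * hn s v) * hn s a" .
      have "L2_set q F \<le> (\<Sum>\<^sub>\<infinity>n. cmod (a n)) * hn s v"
        unfolding q_def using that av \<beta> nn by (intro young_convolution(3)) auto
      also have "\<dots> \<le> (br_const * hn s a) * hn s v"
        using av by (intro mult_right_mono) auto
      finally show "L2_set q F \<le> (br_const * hn s a) * hn s v" .
    qed auto
    finally show ?thesis
      by (simp add: algebra_simps)
  qed
  show "cmul a v \<in> Hs s" "hn s (cmul a v) \<le> 2 powr s * (2 * br_const * hn s a) * hn s v"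
    using Hs_bound[of "cmul a v" s, OF *] by auto
qed

lemma cmul_diff:
  assumes "a \<in> Hs 1" "u \<in> Hs 0" "v \<in> Hs 0"
  shows "cmul a (\<lambda>m. u m - v m) m = cmul a u m - cmul a v m"
  using cmul_summable(2)[OF assms(1,2), of m] cmul_summable(2)[OF assms(1,3), of m]
    infsum_add[of "\<lambda>n. a (m - n) * u n" UNIV "\<lambda>n. - (a (m - n) * v n)"]
  by (simp add: cmul_def right_diff_distrib infsum_uminus summable_on_uminus)

section \<open>Mapping properties of the variable-coefficient part\<close>

lemma dth_Hs:
  assumes "u \<in> Hs (s + real p)" "j \<le> p"
  shows "dth j u \<in> Hs s" "hn s (dth j u) \<le> hn (s + real p) u"
proof -
  have "cmod (dth j u m) * br m powr s \<le> 1 * (cmod (u m) * br m powr (s + real p))" for m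
  proof -
    have "\<bar>real_of_int m\<bar> ^ j \<le> br m ^ j"
      by (intro power_mono) (auto simp: br_def)
    also have "\<dots> \<le> br m ^ p"
      using assms(2) by (intro power_increasing) auto
    finally have "\<bar>real_of_int m\<bar> ^ j * (cmod (u m) * br m powr s) \<le> br m ^ p * (cmod (u m) * br m powr s)"
      by (intro mult_right_mono) auto
    then show ?thesis
      by (simp add: dth_def norm_mult norm_power powr_add powr_realpow mult_ac)
  qed
  from Hs_compare[OF assms(1) zero_le_one this]
  show "dth j u \<in> Hs s" "hn s (dth j u) \<le> hn (s + real p) u"
    by auto
qed

text \<open>For \<open>0 < t \<le> 1/2\<close> the space \<open>H\<^sup>t\<close> does not embed into the sequences with absolutely summable
  coefficients, so the convolution estimate needs \<open>t = 0\<close> or \<open>t \<ge> 1\<close>.\<close>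

lemma L1op_bounded:
  assumes "\<forall>j\<le>p. a j \<in> Hs r" "1 \<le> r" "t = 0 \<or> 1 \<le> t \<and> t \<le> r"
  obtains C where "0 < C" "\<And>v. v \<in> Hs (t + real p) \<Longrightarrow> L1op p a v \<in> Hs t"
    "\<And>v. v \<in> Hs (t + real p) \<Longrightarrow> hn t (L1op p a v) \<le> C * hn (t + real p) v"
proof -
  have "\<exists>c\<ge>0. \<forall>v\<in>Hs t. cmul (a j) v \<in> Hs t \<and> hn t (cmul (a j) v) \<le> c * hn t v" if "j \<le> p" for j
  proof (cases "t = 0")
    case True
    then show ?thesis
      using cmul_Hs_0[of "a j"] Hs_mono[of "a j" r 1] assms(1,2) that
      by (intro exI[of _ "br_const * hn 1 (a j)"]) auto
  next
    case False
    then show ?thesis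
      using cmul_Hs[of t "a j"] Hs_mono[of "a j" r t] assms that
      by (intro exI[of _ "2 powr t * (2 * br_const * hn t (a j))"]) auto
  qed
  then obtain c where c: "\<And>j. j \<le> p \<Longrightarrow> 0 \<le> c j"
    "\<And>j v. j \<le> p \<Longrightarrow> v \<in> Hs t \<Longrightarrow> cmul (a j) v \<in> Hs t"
    "\<And>j v. j \<le> p \<Longrightarrow> v \<in> Hs t \<Longrightarrow> hn t (cmul (a j) v) \<le> c j * hn t v"
    by metis
  define C where "C = 1 + (\<Sum>j=0..p. c j)"
  have S: "0 \<le> (\<Sum>j=0..p. c j)"
    using c by (intro sum_nonneg) auto
  have *: "L1op p a v \<in> Hs t \<and> hn t (L1op p a v) \<le> C * hn (t + real p) v"
    if v: "v \<in> Hs (t + real p)" for v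
  proof -
    have "L1op p a v \<in> Hs t \<and> hn t (L1op p a v) \<le> (\<Sum>j=0..p. hn t (cmul (a j) (dth j v)))"
      unfolding L1op_def using c dth_Hs[OF v] by (intro Hs_sum) auto
    moreover have "(\<Sum>j=0..p. hn t (cmul (a j) (dth j v))) \<le> (\<Sum>j=0..p. c j * hn (t + real p) v)"
    proof (intro sum_mono)
      fix j assume "j \<in> {0..p}"
      then have "hn t (cmul (a j) (dth j v)) \<le> c j * hn t (dth j v)" "hn t (dth j v) \<le> hn (t + real p) v" "0 \<le> c j"
        using c dth_Hs[OF v] by auto
      then show "hn t (cmul (a j) (dth j v)) \<le> c j * hn (t + real p) v"
        by (meson mult_left_mono order_trans)
    qed
    moreover have "(\<Sum>j=0..p. c j * hn (t + real p) v) \<le> C * hn (t + real p) v"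
      by (simp add: C_def sum_distrib_right[symmetric] algebra_simps)
    ultimately show ?thesis
      by linarith
  qed
  show ?thesis
    using * S by (intro that[of C]) (auto simp: C_def)
qed

lemma L1op_diff:
  assumes "\<forall>j\<le>p. a j \<in> Hs r" "1 \<le> r" "u \<in> Hs (real p)" "v \<in> Hs (real p)"
  shows "L1op p a (\<lambda>m. u m - v m) m = L1op p a u m - L1op p a v m"
proof -
  have "cmul (a j) (dth j (\<lambda>m. u m - v m)) m = cmul (a j) (dth j u) m - cmul (a j) (dth j v) m"
    if "j \<le> p" for j
  proof -
    have "dth j (\<lambda>m. u m - v m) = (\<lambda>m. dth j u m - dth j v m)"
      by (auto simp: dth_def right_diff_distrib)
    moreover have "dth j u \<in> Hs 0" "dth j v \<in> Hs 0" "a j \<in> Hs 1"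
      using dth_Hs[of _ 0 p j] Hs_mono[of "a j" r 1] assms that by auto
    ultimately show ?thesis
      using cmul_diff by simp
  qed
  then show ?thesis
    by (simp add: L1op_def sum_subtractf)
qed

section \<open>Truncation and the symbol\<close>

definition QN :: "nat \<Rightarrow> fseq \<Rightarrow> fseq" where
  "QN N u = (\<lambda>j. u j - PN N u j)"

definition freqs :: "nat \<Rightarrow> int set" where
  "freqs N = {- int (N div 2)..int ((N - 1) div 2)}"

lemma finite_freqs [simp]: "finite (freqs N)"
  by (simp add: freqs_def)

lemma PN_eq: "PN N u j = (if j \<in> freqs N then u j else 0)"
  by (simp add: PN_def freqs_def)

lemma QN_eq: "QN N u j = (if j \<in> freqs N then 0 else u j)"
  by (simp add: QN_def PN_eq)

lemma PN_fixed_iff: "PN N u = u \<longleftrightarrow> (\<forall>j. j \<notin> freqs N \<longrightarrow> u j = 0)"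
  by (auto simp: PN_eq fun_eq_iff)

lemma br_le_freqs:
  assumes "j \<in> freqs N" "1 \<le> N"
  shows "br j \<le> real N"
proof -
  have "\<bar>j\<bar> \<le> int N"
    using assms unfolding freqs_def atLeastAtMost_iff by linarith
  then have "real_of_int \<bar>j\<bar> \<le> real N"
    by (metis of_int_le_iff of_int_of_nat_eq)
  then show ?thesis
    using assms(2) by (simp add: br_def)
qed

text \<open>For even \<open>N\<close> the range is asymmetric: the frequency \<open>N / 2\<close>
  already lies outside, so the bound is attained there for \<open>N \<ge> 2\<close>.\<close>

lemma br_ge_freqs:
  assumes "j \<notin> freqs N"
  shows "real N / 2 \<le> br j"
proof -
  have "int N \<le> 2 * \<bar>j\<bar>"
    using assms unfolding freqs_def atLeastAtMost_iff by linarith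
  then have "real N \<le> 2 * real_of_int \<bar>j\<bar>"
    by linarith
  then show ?thesis
    by (simp add: br_def)
qed

lemma PN_Hs:
  assumes "u \<in> Hs s"
  shows "PN N u \<in> Hs s" "hn s (PN N u) \<le> hn s u"
  using Hs_compare[OF assms zero_le_one, of "PN N u" s] by (auto simp: PN_eq)

lemma finite_support_Hs:
  assumes "finite F" "\<And>n. n \<notin> F \<Longrightarrow> u n = 0"
  shows "u \<in> Hs s"
proof -
  have "(\<lambda>j. (cmod (u j))\<^sup>2 * sob_wt s j) summable_on F \<longleftrightarrow>
      (\<lambda>j. (cmod (u j))\<^sup>2 * sob_wt s j) summable_on UNIV"
    using assms by (intro summable_on_cong_neutral) auto
  then show ?thesis
    using assms(1) by (simp add: Hs_def)
qed

lemma PN_fixed_Hs: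
  assumes "PN N u = u"
  shows "u \<in> Hs s"
  using assms by (intro finite_support_Hs[OF finite_freqs[of N]]) (simp add: PN_fixed_iff)

text \<open>Bernstein's inequality: only frequencies of size at most \<open>N\<close> occur, so
  raising the order by \<open>t - s\<close> costs at most \<open>N\<close> to that power.\<close>

lemma PN_fixed_inverse_inequality:
  assumes "PN N u = u" "1 \<le> N" "s \<le> t"
  shows "hn t u \<le> real N powr (t - s) * hn s u"
proof -
  have "cmod (u j) * br j powr t \<le> real N powr (t - s) * (cmod (u j) * br j powr s)" for j
  proof (cases "j \<in> freqs N")
    case True
    have "br j powr t = br j powr (t - s) * br j powr s"
      by (simp add: powr_add[symmetric])
    also have "\<dots> \<le> real N powr (t - s) * br j powr s"
      using assms br_le_freqs[OF True] by (intro mult_right_mono powr_mono2) (auto simp: less_imp_le)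
    finally have "cmod (u j) * br j powr t \<le> cmod (u j) * (real N powr (t - s) * br j powr s)"
      by (rule mult_left_mono) simp
    then show ?thesis
      by (simp add: mult_ac)
  next
    case False
    then show ?thesis
      using assms by (simp add: PN_fixed_iff)
  qed
  then show ?thesis
    by (intro Hs_compare(2)[OF PN_fixed_Hs[OF assms(1)]]) auto
qed

text \<open>The converse direct estimate: the tail lives at frequencies of size at least
  \<open>N / 2\<close>, which gives the decay in \<open>N\<close> and the factor
  \<open>2 powr (t - s)\<close>.\<close>

lemma QN_Hs:
  assumes "v \<in> Hs t" "s \<le> t" "1 \<le> N"
  shows "QN N v \<in> Hs s" "hn s (QN N v) \<le> 2 powr (t - s) * real N powr (s - t) * hn t v"
proof -
  have N: "2 powr (t - s) * real N powr (s - t) = (real N / 2) powr (s - t)"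
    using assms(3) by (simp add: powr_divide powr_diff field_simps)
  have "cmod (QN N v j) * br j powr s \<le> (real N / 2) powr (s - t) * (cmod (v j) * br j powr t)" for j
  proof (cases "j \<in> freqs N")
    case False
    have "br j powr s = br j powr (s - t) * br j powr t"
      by (simp add: powr_add[symmetric])
    also have "\<dots> \<le> (real N / 2) powr (s - t) * br j powr t"
      using assms br_ge_freqs[OF False] by (intro mult_right_mono powr_mono2') auto
    finally have "cmod (v j) * br j powr s \<le> cmod (v j) * ((real N / 2) powr (s - t) * br j powr t)"
      by (rule mult_left_mono) simp
    then show ?thesis
      using False by (simp add: QN_eq mult_ac)
  qed (simp add: QN_eq)
  from Hs_compare[OF assms(1) _ this]
  show "QN N v \<in> Hs s" "hn s (QN N v) \<le> 2 powr (t - s) * real N powr (s - t) * hn t v"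
    by (auto simp: N)
qed

section \<open>Growth and ellipticity of the constant-coefficient symbol\<close>

lemma L0op_eq: "L0op q k cc u m = symb q k cc m * u m"
  by (simp add: L0op_def symb_def dth_def sum_distrib_right mult.assoc)

lemma L1op_zero [simp]: "L1op p a (\<lambda>_. 0) = (\<lambda>_. 0)"
  by (simp add: L1op_def cmul_def dth_def)

lemma symb_upper:
  obtains C where "0 < C" "\<And>m. cmod (symb q k cc m) \<le> C * br m ^ k"
proof -
  define C where "C = 1 + (\<Sum>j=q..k. cmod (cc j))"
  have le: "cmod (symb q k cc m) \<le> C * br m ^ k" for m
  proof -
    have "cmod (symb q k cc m) \<le> (\<Sum>j=q..k. cmod (cc j * (\<i> * of_int m) ^ j))"
      unfolding symb_def by (rule norm_sum)
    also have "\<dots> \<le> (\<Sum>j=q..k. cmod (cc j) * br m ^ k)"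
    proof (intro sum_mono)
      fix j assume "j \<in> {q..k}"
      then have "\<bar>real_of_int m\<bar> ^ j \<le> br m ^ j" "br m ^ j \<le> br m ^ k"
        by (auto intro!: power_mono power_increasing simp: br_def)
      then show "cmod (cc j * (\<i> * of_int m) ^ j) \<le> cmod (cc j) * br m ^ k"
        by (auto simp: norm_mult norm_power intro!: mult_left_mono)
    qed
    also have "\<dots> \<le> C * br m ^ k"
      by (simp add: C_def sum_distrib_right[symmetric] algebra_simps)
    finally show ?thesis .
  qed
  show ?thesis
    using le by (intro that[of C]) (auto simp: C_def intro!: add_pos_nonneg sum_nonneg)
qed

lemma symb_lower:
  assumes "cc k \<noteq> 0" "q \<le> k" "1 \<le> k"
  obtains c R where "0 < c" "1 \<le> R" "\<And>m. R \<le> br m \<Longrightarrow> c * br m ^ k \<le> cmod (symb q k cc m)"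
proof -
  define S where "S = (\<Sum>j=q..<k. cmod (cc j))"
  \<comment> \<open>The summand \<open>2 * S / cmod (cc k)\<close> lets half of the leading term
    absorb all lower ones; the summand 2 excludes the frequency 0, so that \<open>br m\<close> is
    the true modulus of \<open>m\<close>.\<close>
  define R where "R = 2 + 2 * S / cmod (cc k)"
  have S: "0 \<le> S"
    by (auto simp: S_def intro: sum_nonneg)
  have R: "2 \<le> R"
    using S by (simp add: R_def)
  have "cmod (cc k) / 2 * br m ^ k \<le> cmod (symb q k cc m)" if m: "R \<le> br m" for m
  proof -
    have abs: "\<bar>real_of_int m\<bar> = br m"
      using m R by (simp add: br_def max_def split: if_splits)
    have "{q..k} = insert k {q..<k}"
      using assms(2) by auto
    then have eq: "symb q k cc m = cc k * (\<i> * of_int m) ^ k + (\<Sum>j=q..<k. cc j * (\<i> * of_int m) ^ j)"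
      by (simp add: symb_def)
    have pow: "br m ^ k = br m * br m ^ (k - 1)"
      using assms(3) by (simp add: power_eq_if)
    have "cmod (\<Sum>j=q..<k. cc j * (\<i> * of_int m) ^ j) \<le> (\<Sum>j=q..<k. cmod (cc j) * br m ^ (k - 1))"
    proof (rule sum_norm_le)
      fix j assume "j \<in> {q..<k}"
      then have "br m ^ j \<le> br m ^ (k - 1)"
        by (intro power_increasing) auto
      then show "cmod (cc j * (\<i> * of_int m) ^ j) \<le> cmod (cc j) * br m ^ (k - 1)"
        by (auto simp: norm_mult norm_power abs intro!: mult_left_mono)
    qed
    also have "\<dots> = S * br m ^ (k - 1)"
      by (simp add: S_def sum_distrib_right)
    also have "\<dots> \<le> cmod (cc k) / 2 * br m * br m ^ (k - 1)"
    proof (intro mult_right_mono)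
      have "2 * S / cmod (cc k) \<le> br m"
        using m by (simp add: R_def)
      then show "S \<le> cmod (cc k) / 2 * br m"
        using assms(1) by (simp add: field_simps)
    qed simp
    finally have "cmod (\<Sum>j=q..<k. cc j * (\<i> * of_int m) ^ j) \<le> cmod (cc k) / 2 * br m ^ k"
      by (simp add: pow)
    moreover have "cmod (cc k * (\<i> * of_int m) ^ k) = cmod (cc k) * br m ^ k"
      by (simp add: norm_mult norm_power abs)
    moreover have "cmod (cc k * (\<i> * of_int m) ^ k) - cmod (\<Sum>j=q..<k. cc j * (\<i> * of_int m) ^ j)
        \<le> cmod (symb q k cc m)"
      unfolding eq by (rule norm_diff_ineq)
    ultimately show ?thesis
      by linarith
  qed
  then show ?thesis
    using assms(1) R by (intro that[of "cmod (cc k) / 2" R]) auto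
qed

lemma finite_br_less: "finite {m. br m < R}"
proof (rule finite_subset)
  show "{m. br m < R} \<subseteq> {- \<lceil>R\<rceil>..\<lceil>R\<rceil>}"
    by (auto simp: br_def) linarith+
qed simp

text \<open>At high frequencies the leading term dominates \<open>\<zeta>\<close>; the finitely many
  remaining ratios are positive because the symbol never takes the value \<open>\<zeta>\<close>, so
  they have a positive minimum.\<close>

lemma symb_shift_lower:
  assumes "cc k \<noteq> 0" "q \<le> k" "1 \<le> k" "\<forall>m. \<zeta> \<noteq> symb q k cc m"
  obtains c where "0 < c" "\<And>m. c * br m ^ k \<le> cmod (symb q k cc m - \<zeta>)"
proof -
  obtain c R where c: "0 < c" "1 \<le> R" "\<And>m. R \<le> br m \<Longrightarrow> c * br m ^ k \<le> cmod (symb q k cc m)"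
    using symb_lower[of cc k q] assms(1-3) by metis
  define T where "T = max R (2 * cmod \<zeta> / c)"
  \<comment> \<open>The element \<open>c / 2\<close> is the ellipticity constant valid beyond
    \<open>T\<close>; \<open>Min X\<close> then serves both ranges, and \<open>X\<close> is never
    empty.\<close>
  define X where "X = insert (c / 2) ((\<lambda>m. cmod (symb q k cc m - \<zeta>) / br m ^ k) ` {m. br m < T})"
  have X: "finite X" "X \<noteq> {}"
    by (auto simp: X_def finite_br_less)
  have nz: "symb q k cc m - \<zeta> \<noteq> 0" for m
    using assms(4)[rule_format, of m] by auto
  have "0 < Min X"
    using X nz c by (auto simp: X_def Min_gr_iff[OF X])
  moreover have "Min X * br m ^ k \<le> cmod (symb q k cc m - \<zeta>)" for m
  proof (cases "br m < T")
    case True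
    then have "Min X \<le> cmod (symb q k cc m - \<zeta>) / br m ^ k"
      using X by (intro Min_le) (auto simp: X_def)
    then show ?thesis
      by (simp add: field_simps)
  next
    case False
    then have "2 * cmod \<zeta> / c \<le> br m" "R \<le> br m"
      by (auto simp: T_def)
    then have "cmod \<zeta> \<le> c / 2 * br m"
      using c by (simp add: field_simps)
    also have "\<dots> \<le> c / 2 * br m ^ k"
      using c assms(3) by (intro mult_left_mono self_le_power) auto
    finally have "c / 2 * br m ^ k \<le> cmod (symb q k cc m - \<zeta>)"
      using c(3)[OF \<open>R \<le> br m\<close>] norm_triangle_ineq2[of "symb q k cc m" \<zeta>] by linarith
    moreover have "Min X * br m ^ k \<le> c / 2 * br m ^ k"
      using X by (intro mult_right_mono Min_le) (auto simp: X_def)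
    ultimately show ?thesis
      by linarith
  qed
  ultimately show ?thesis
    using that by blast
qed

lemma Nop_Hs:
  assumes "0 < c" "\<And>m. c * br m ^ k \<le> cmod (symb q k cc m - \<zeta>)" "v \<in> Hs s"
  shows "Nop q k cc \<zeta> v \<in> Hs (s + real k)" "hn (s + real k) (Nop q k cc \<zeta> v) \<le> 1 / c * hn s v"
proof -
  have "cmod (Nop q k cc \<zeta> v m) * br m powr (s + real k) \<le> 1 / c * (cmod (v m) * br m powr s)" for m
  proof -
    have pos: "0 < c * br m ^ k"
      using assms(1) by simp
    have "cmod (v m) / cmod (symb q k cc m - \<zeta>) \<le> cmod (v m) / (c * br m ^ k)"
      using assms(2)[of m] pos by (intro divide_left_mono mult_pos_pos[of "cmod _"]) auto
    then have "cmod (Nop q k cc \<zeta> v m) * (br m powr s * br m ^ k)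
        \<le> cmod (v m) / (c * br m ^ k) * (br m powr s * br m ^ k)"
      unfolding Nop_def norm_divide by (rule mult_right_mono) simp
    then show ?thesis
      using assms(1) by (simp add: powr_add powr_realpow field_simps)
  qed
  from Hs_compare[OF assms(3) _ this]
  show "Nop q k cc \<zeta> v \<in> Hs (s + real k)" "hn (s + real k) (Nop q k cc \<zeta> v) \<le> 1 / c * hn s v"
    using assms(1) by auto
qed

text \<open>The tail estimate from order 0 down to \<open>s - k\<close> gains
  \<open>N powr (s - k)\<close>; returning from the \<open>Hs p\<close> norm of \<open>u\<close> to
  the \<open>Hs s\<close> norm costs \<open>N powr (p - s)\<close> by Bernstein. The product is
  \<open>N powr (p - k)\<close>, whatever \<open>s \<le> p\<close> is.\<close>

lemma truncation_residual:
  assumes "\<forall>j\<le>p. a j \<in> Hs r" "1 \<le> r" "p < k" "s \<le> real p"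
  obtains C where "0 < C"
    "\<And>N u. 1 \<le> N \<Longrightarrow> PN N u = u \<Longrightarrow> QN N (L1op p a u) \<in> Hs (s - real k)"
    "\<And>N u. 1 \<le> N \<Longrightarrow> PN N u = u \<Longrightarrow>
      hn (s - real k) (QN N (L1op p a u)) \<le> C * real N powr (real p - real k) * hn s u"
proof -
  obtain C where C: "0 < C" "\<And>v. v \<in> Hs (real p) \<Longrightarrow> L1op p a v \<in> Hs 0"
    "\<And>v. v \<in> Hs (real p) \<Longrightarrow> hn 0 (L1op p a v) \<le> C * hn (real p) v"
    using L1op_bounded[OF assms(1,2), of 0] by auto
  define D where "D = 2 powr (real k - s) * C"
  have "QN N (L1op p a u) \<in> Hs (s - real k) \<and>
      hn (s - real k) (QN N (L1op p a u)) \<le> D * real N powr (real p - real k) * hn s u"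
    if N: "1 \<le> N" and u: "PN N u = u" for N u
  proof -
    have up: "u \<in> Hs (real p)"
      by (rule PN_fixed_Hs[OF u])
    have "hn (s - real k) (QN N (L1op p a u))
        \<le> 2 powr (real k - s) * real N powr (s - real k) * hn 0 (L1op p a u)"
      using QN_Hs(2)[OF C(2)[OF up], of "s - real k" N] N assms(3,4) by simp
    also have "\<dots> \<le> 2 powr (real k - s) * real N powr (s - real k) * (C * hn (real p) u)"
      by (intro mult_left_mono C up) auto
    also have "\<dots> \<le> 2 powr (real k - s) * real N powr (s - real k) * (C * (real N powr (real p - s) * hn s u))"
      using C by (intro mult_left_mono PN_fixed_inverse_inequality u N assms) auto
    also have "\<dots> = D * (real N powr (s - real k) * real N powr (real p - s)) * hn s u"
      by (simp add: D_def)
    also have "real N powr (s - real k) * real N powr (real p - s) = real N powr (real p - real k)"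
      by (simp add: powr_add[symmetric])
    finally show ?thesis
      using QN_Hs(1)[OF C(2)[OF up], of "s - real k" N] N assms(3,4) by simp
  qed
  then show ?thesis
    using C(1) by (intro that[of D]) (auto simp: D_def)
qed

lemma eigen_residual:
  assumes "(\<lambda>m. L0op q k cc u m + PN N (L1op p a u) m) = (\<lambda>m. \<mu> * u m)"
  shows "shift_op \<mu> (Lop q k cc p a) u = (\<lambda>m. - QN N (L1op p a u) m)"
proof
  fix m
  have "L0op q k cc u m + PN N (L1op p a u) m = \<mu> * u m"
    by (rule fun_cong[OF assms])
  then show "shift_op \<mu> (Lop q k cc p a) u m = - QN N (L1op p a u) m"
    by (simp add: shift_op_def Lop_def QN_def algebra_simps)
qed

lemma shift_op_zero [simp]: "shift_op \<mu> (Lop q k cc p a) (\<lambda>_. 0) = (\<lambda>_. 0)"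
  by (simp add: shift_op_def Lop_def L0op_eq)

text \<open>Without bijectivity the inverse norm is infinite, so the estimate for \<open>T u\<close>
  is demanded only under bijectivity. Bijectivity also gives \<open>T u \<noteq> 0\<close>, so the
  quotient in the supremum is not a division by zero.\<close>

lemma inv_opnorm_ge:
  assumes "T (\<lambda>_. 0) = (\<lambda>_. 0)" "(\<lambda>_. 0) \<in> V" "u \<in> V" "u \<noteq> (\<lambda>_. 0)"
    and "0 < D" and pos: "\<And>w. w \<in> W \<Longrightarrow> w \<noteq> (\<lambda>_. 0) \<Longrightarrow> 0 < nW w"
    and "bij_betw T V W \<Longrightarrow> nW (T u) \<le> D * nV u"
  shows "ereal (1 / D) \<le> inv_opnorm T V nV W nW"
proof (cases "bij_betw T V W")
  case True
  have "T u \<noteq> (\<lambda>_. 0)"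
    using True assms(1-4) by (metis bij_betw_imp_inj_on inj_onD)
  then have "0 < nW (T u)"
    using True assms(3) by (intro pos) (auto dest: bij_betwE)
  moreover have "nW (T u) \<le> D * nV u"
    by (rule assms(7)[OF True])
  ultimately have "1 / D \<le> nV u / nW (T u)"
    using \<open>0 < D\<close> by (simp add: field_simps)
  then have "ereal (1 / D) \<le> ereal (nV u / nW (T u))"
    by simp
  also have "\<dots> \<le> (SUP u \<in> V - {(\<lambda>_. 0)}. ereal (nV u / nW (T u)))"
    using assms(3,4) by (intro SUP_upper) auto
  finally show ?thesis
    using True by (simp add: inv_opnorm_def)
qed (simp add: inv_opnorm_def)

section \<open>Pseudomodes from truncated eigenvectors\<close>

text \<open>The exponent \<open>r\<close> is kept free because the argument is later run with
  \<open>max r (s - real k)\<close>, which can exceed the smoothness given at the start.\<close>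

locale perturbed_symbol =
  fixes k p q :: nat and cc :: "nat \<Rightarrow> complex" and a :: "nat \<Rightarrow> fseq" and r :: real
  assumes p_less_k: "p < k" and q_le_k: "q \<le> k" and lead: "cc k \<noteq> 0"
    and coeffs: "\<forall>j\<le>p. a j \<in> Hs r" and r_ge_1: "1 \<le> r"
begin

abbreviation "L1 \<equiv> L1op p a"
abbreviation "\<sigma> \<equiv> symb q k cc"

text \<open>If \<open>(\<mu> - L) u = f\<close>, replacing \<open>u\<close> by \<open>u - H f\<close>, with \<open>H\<close> the inverse of \<open>\<mu> - L\<^sub>0\<close> on the
  frequencies \<open>\<ge> \<kappa>\<close>, turns the right-hand side into \<open>L\<^sub>1 H f\<close>, which is smoother by \<open>k - p\<close> orders, plus
  a part of frequencies \<open>< \<kappa>\<close>. The functions \<open>residual\<close> and \<open>corrected\<close> iterate this step, and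
  \<open>res_order\<close> records the smoothness gained, which is capped by that of the coefficients.\<close>

definition hf_inverse :: "real \<Rightarrow> complex \<Rightarrow> fseq \<Rightarrow> fseq" where
  "hf_inverse \<kappa> \<mu> f = (\<lambda>m. if \<kappa> \<le> br m then f m / (\<mu> - \<sigma> m) else 0)"

text \<open>The estimates see \<open>\<mu>\<close> only through \<open>c\<close> and
  \<open>\<kappa>\<close>; fixing \<open>c\<close> in advance makes them uniform in
  \<open>\<mu>\<close>.\<close>

definition elliptic_above :: "real \<Rightarrow> real \<Rightarrow> complex \<Rightarrow> bool" where
  "elliptic_above c \<kappa> \<mu> \<longleftrightarrow> (\<forall>m. \<kappa> \<le> br m \<longrightarrow> c * br m ^ k \<le> cmod (\<mu> - \<sigma> m))"

primrec residual :: "real \<Rightarrow> complex \<Rightarrow> fseq \<Rightarrow> nat \<Rightarrow> fseq" where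
  "residual \<kappa> \<mu> f 0 = f"
| "residual \<kappa> \<mu> f (Suc i) = L1 (hf_inverse \<kappa> \<mu> (residual \<kappa> \<mu> f i))"

primrec corrected :: "real \<Rightarrow> complex \<Rightarrow> fseq \<Rightarrow> fseq \<Rightarrow> nat \<Rightarrow> fseq" where
  "corrected \<kappa> \<mu> f u 0 = u"
| "corrected \<kappa> \<mu> f u (Suc i) = (\<lambda>m. corrected \<kappa> \<mu> f u i m - hf_inverse \<kappa> \<mu> (residual \<kappa> \<mu> f i) m)"

primrec res_order :: "nat \<Rightarrow> real" where
  "res_order 0 = real p - real k"
| "res_order (Suc i) = min (real i * (real k - real p)) r"

section \<open>Iterated residuals: orders, norms and the telescoping identity\<close>

lemma k_minus_p: "1 \<le> real k - real p"
  using p_less_k by linarith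

lemma res_order_ge: "real p - real k \<le> res_order i"
proof (cases i)
  case (Suc j)
  have "0 \<le> real j * (real k - real p)"
    using k_minus_p by simp
  then show ?thesis
    unfolding Suc res_order.simps min.bounded_iff using k_minus_p r_ge_1 by linarith
qed simp

text \<open>The order budget of one step: the high-frequency inverse gains \<open>k\<close> orders
  and \<open>L1\<close> consumes \<open>p\<close>.\<close>

lemma res_order_Suc: "res_order (Suc i) + real p \<le> res_order i + real k"
  using k_minus_p r_ge_1 by (cases i) (auto simp: algebra_simps min_def)

text \<open>Since \<open>k - p\<close> is at least 1, the orders jump from 0 to at least 1 and avoid
  the gap excluded in \<open>L1op_bounded\<close>.\<close>

lemma res_order_Suc_range: "res_order (Suc i) = 0 \<or> 1 \<le> res_order (Suc i) \<and> res_order (Suc i) \<le> r"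
proof (cases i)
  case (Suc j)
  have "1 \<le> real i * (real k - real p)"
    using k_minus_p mult_mono[of 1 "real i" 1 "real k - real p"] by (simp add: Suc)
  then show ?thesis
    using r_ge_1 by simp
qed (use r_ge_1 in simp)

lemma hf_inverse_Hs:
  assumes "0 < c" "elliptic_above c \<kappa> \<mu>" "f \<in> Hs t"
  shows "hf_inverse \<kappa> \<mu> f \<in> Hs (t + real k)" "hn (t + real k) (hf_inverse \<kappa> \<mu> f) \<le> 1 / c * hn t f"
proof -
  have "cmod (hf_inverse \<kappa> \<mu> f m) * br m powr (t + real k) \<le> 1 / c * (cmod (f m) * br m powr t)" for m
  proof (cases "\<kappa> \<le> br m")
    case True
    have le: "c * br m ^ k \<le> cmod (\<mu> - \<sigma> m)" and pos: "0 < c * br m ^ k"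
      using assms(1,2) True by (auto simp: elliptic_above_def)
    then have "cmod (f m) / cmod (\<mu> - \<sigma> m) \<le> cmod (f m) / (c * br m ^ k)"
      by (intro divide_left_mono mult_pos_pos[of "cmod _"]) auto
    then have "cmod (f m) / cmod (\<mu> - \<sigma> m) * (br m powr t * br m ^ k)
        \<le> cmod (f m) / (c * br m ^ k) * (br m powr t * br m ^ k)"
      by (rule mult_right_mono) simp
    then show ?thesis
      using assms(1) True by (simp add: hf_inverse_def norm_divide powr_add powr_realpow field_simps)
  qed (use assms(1) in \<open>simp add: hf_inverse_def\<close>)
  from Hs_compare[OF assms(3) _ this]
  show "hf_inverse \<kappa> \<mu> f \<in> Hs (t + real k)" "hn (t + real k) (hf_inverse \<kappa> \<mu> f) \<le> 1 / c * hn t f"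
    using assms(1) by auto
qed

text \<open>The constant is chosen before \<open>\<kappa>\<close>, \<open>\<mu>\<close> and
  \<open>f\<close>, so it does not depend on the eigenvalue. The induction composes
  \<open>hf_inverse_Hs\<close> with the boundedness of \<open>L1\<close>.\<close>

lemma residual_bound:
  assumes "0 < c"
  shows "\<exists>C\<ge>0. \<forall>\<kappa> \<mu> f. elliptic_above c \<kappa> \<mu> \<longrightarrow> f \<in> Hs (real p - real k) \<longrightarrow>
    residual \<kappa> \<mu> f i \<in> Hs (res_order i) \<and>
    hn (res_order i) (residual \<kappa> \<mu> f i) \<le> C * hn (real p - real k) f"
proof (induction i)
  case 0
  show ?case
    by (intro exI[of _ 1]) simp
next
  case (Suc i)
  then obtain C where C: "0 \<le> C" and IH: "\<And>\<kappa> \<mu> f. elliptic_above c \<kappa> \<mu> \<Longrightarrow> f \<in> Hs (real p - real k) \<Longrightarrow>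
    residual \<kappa> \<mu> f i \<in> Hs (res_order i) \<and>
    hn (res_order i) (residual \<kappa> \<mu> f i) \<le> C * hn (real p - real k) f"
    by blast
  obtain C1 where C1: "0 < C1"
    "\<And>v. v \<in> Hs (res_order (Suc i) + real p) \<Longrightarrow> L1 v \<in> Hs (res_order (Suc i))"
    "\<And>v. v \<in> Hs (res_order (Suc i) + real p) \<Longrightarrow>
      hn (res_order (Suc i)) (L1 v) \<le> C1 * hn (res_order (Suc i) + real p) v"
    by (rule L1op_bounded[OF coeffs r_ge_1 res_order_Suc_range[of i]]) blast
  have "residual \<kappa> \<mu> f (Suc i) \<in> Hs (res_order (Suc i)) \<and>
    hn (res_order (Suc i)) (residual \<kappa> \<mu> f (Suc i)) \<le> (C1 * (1 / c * C)) * hn (real p - real k) f"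
    if el: "elliptic_above c \<kappa> \<mu>" and f: "f \<in> Hs (real p - real k)" for \<kappa> \<mu> f
  proof -
    define g where "g = residual \<kappa> \<mu> f i"
    have g: "g \<in> Hs (res_order i)" "hn (res_order i) g \<le> C * hn (real p - real k) f"
      using IH[OF el f] by (auto simp: g_def)
    note h = hf_inverse_Hs[OF assms el g(1)]
    have h': "hf_inverse \<kappa> \<mu> g \<in> Hs (res_order (Suc i) + real p)"
      "hn (res_order (Suc i) + real p) (hf_inverse \<kappa> \<mu> g) \<le> hn (res_order i + real k) (hf_inverse \<kappa> \<mu> g)"
      using Hs_mono[OF h(1) res_order_Suc] by auto
    have "hn (res_order (Suc i)) (L1 (hf_inverse \<kappa> \<mu> g)) \<le>
        C1 * hn (res_order (Suc i) + real p) (hf_inverse \<kappa> \<mu> g)"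
      by (rule C1(3)[OF h'(1)])
    also have "\<dots> \<le> C1 * (1 / c * hn (res_order i) g)"
      using C1(1) h(2) h'(2) by (intro mult_left_mono) linarith+
    also have "\<dots> \<le> C1 * (1 / c * (C * hn (real p - real k) f))"
      using C1(1) g(2) assms by (intro mult_left_mono) auto
    finally show ?thesis
      using C1(2)[OF h'(1)] by (simp add: g_def mult.assoc)
  qed
  then show ?case
    using C C1(1) assms by (intro exI[of _ "C1 * (1 / c * C)"]) auto
qed

text \<open>A qualitative companion to \<open>residual_bound\<close>: one step does not leave
  \<open>Hs r\<close> because \<open>p < k\<close>. It supplies the membership needed for linearity
  of \<open>L1\<close>.\<close>

lemma residual_Hs_r:
  assumes "0 < c" "elliptic_above c \<kappa> \<mu>" "f \<in> Hs r"
  shows "residual \<kappa> \<mu> f i \<in> Hs r"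
proof (induction i)
  case (Suc i)
  have "hf_inverse \<kappa> \<mu> (residual \<kappa> \<mu> f i) \<in> Hs (r + real p)"
    using Hs_mono(1)[OF hf_inverse_Hs(1)[OF assms(1,2) Suc], of "r + real p"] p_less_k by simp
  moreover obtain C where "\<And>v. v \<in> Hs (r + real p) \<Longrightarrow> L1 v \<in> Hs r"
    by (rule L1op_bounded[OF coeffs r_ge_1, of r]) (use r_ge_1 in auto)
  ultimately show ?case
    by simp
qed (use assms in simp)

lemma corrected_Hs:
  assumes "0 < c" "elliptic_above c \<kappa> \<mu>" "f \<in> Hs r" "u \<in> Hs (r + real k)"
  shows "corrected \<kappa> \<mu> f u i \<in> Hs (r + real k)"
proof (induction i)
  case (Suc i)
  then show ?case
    using hf_inverse_Hs(1)[OF assms(1,2) residual_Hs_r[OF assms(1-3)]] by (auto intro: Hs_diff)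
qed (use assms in simp)

text \<open>A correction cancels the current residual exactly at frequencies
  \<open>\<ge> \<kappa>\<close> and adds \<open>L1\<close> of the correction. Below
  \<open>\<kappa>\<close> nothing is cancelled, so the old residuals accumulate there as a
  sum.\<close>

lemma corrected_residual:
  assumes "0 < c" "elliptic_above c \<kappa> \<mu>" "f \<in> Hs r" "u \<in> Hs (r + real k)"
    and eq: "\<And>m. (\<mu> - \<sigma> m) * u m - L1 u m = f m"
  shows "(\<mu> - \<sigma> m) * corrected \<kappa> \<mu> f u n m - L1 (corrected \<kappa> \<mu> f u n) m =
    residual \<kappa> \<mu> f n m + (if br m < \<kappa> then \<Sum>i<n. residual \<kappa> \<mu> f i m else 0)"
proof (induction n)
  case (Suc n)
  define w g where "w = corrected \<kappa> \<mu> f u n" and "g = residual \<kappa> \<mu> f n"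
  have wH: "w \<in> Hs (real p)"
    using Hs_mono(1)[OF corrected_Hs[OF assms(1-4)], of "real p" n] r_ge_1 p_less_k by (simp add: w_def)
  have gH: "hf_inverse \<kappa> \<mu> g \<in> Hs (real p)"
    using Hs_mono(1)[OF hf_inverse_Hs(1)[OF assms(1,2) residual_Hs_r[OF assms(1-3)]], of "real p" n]
      r_ge_1 p_less_k by (simp add: g_def)
  have L: "L1 (\<lambda>m. w m - hf_inverse \<kappa> \<mu> g m) m = L1 w m - L1 (hf_inverse \<kappa> \<mu> g) m"
    by (rule L1op_diff[OF coeffs r_ge_1 wH gH])
  have inv: "(\<mu> - \<sigma> m) * hf_inverse \<kappa> \<mu> g m = (if br m < \<kappa> then 0 else g m)"
  proof (cases "br m < \<kappa>")
    case False
    then have "c * br m ^ k \<le> cmod (\<mu> - \<sigma> m)"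
      using assms(2) by (simp add: elliptic_above_def)
    moreover have "0 < c * br m ^ k"
      using assms(1) by simp
    ultimately have "\<mu> - \<sigma> m \<noteq> 0"
      by auto
    then show ?thesis
      using False by (simp add: hf_inverse_def)
  qed (simp add: hf_inverse_def)
  have "(\<mu> - \<sigma> m) * (w m - hf_inverse \<kappa> \<mu> g m) - L1 (\<lambda>m. w m - hf_inverse \<kappa> \<mu> g m) m =
      ((\<mu> - \<sigma> m) * w m - L1 w m) - (\<mu> - \<sigma> m) * hf_inverse \<kappa> \<mu> g m + L1 (hf_inverse \<kappa> \<mu> g) m"
    by (simp add: L algebra_simps)
  also have "\<dots> = L1 (hf_inverse \<kappa> \<mu> g) m + (if br m < \<kappa> then (\<Sum>i<n. residual \<kappa> \<mu> f i m) + g m else 0)"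
    unfolding inv using Suc[folded w_def g_def] by simp
  finally show ?case
    by (simp add: w_def g_def)
qed (simp add: eq)

text \<open>A reverse triangle inequality: the total correction is small in \<open>Hs p\<close> when
  the residuals are small in order \<open>p - k\<close>. This keeps the corrected function away from
  zero.\<close>

lemma corrected_norm:
  assumes "0 < c" "elliptic_above c \<kappa> \<mu>" "f \<in> Hs r" "u \<in> Hs (r + real k)"
  shows "hn (real p) u \<le> hn (real p) (corrected \<kappa> \<mu> f u n) +
    (\<Sum>i<n. 1 / c * hn (real p - real k) (residual \<kappa> \<mu> f i))"
proof (induction n)
  case (Suc n)
  define w g where "w = corrected \<kappa> \<mu> f u n" and "g = residual \<kappa> \<mu> f n"
  have pk: "real p \<le> r + real k"
    using r_ge_1 p_less_k by linarith
  have w': "corrected \<kappa> \<mu> f u (Suc n) \<in> Hs (real p)"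
    using Hs_mono(1)[OF corrected_Hs[OF assms] pk] .
  have g: "g \<in> Hs (real p - real k)"
    using Hs_mono(1)[OF residual_Hs_r[OF assms(1-3)], of "real p - real k" n] r_ge_1 p_less_k
    by (simp add: g_def)
  have h: "hf_inverse \<kappa> \<mu> g \<in> Hs (real p)" "hn (real p) (hf_inverse \<kappa> \<mu> g) \<le> 1 / c * hn (real p - real k) g"
    using hf_inverse_Hs[OF assms(1,2) g] by auto
  have "w = (\<lambda>m. corrected \<kappa> \<mu> f u (Suc n) m + hf_inverse \<kappa> \<mu> g m)"
    by (simp add: w_def g_def)
  then have "hn (real p) w \<le> hn (real p) (corrected \<kappa> \<mu> f u (Suc n)) + hn (real p) (hf_inverse \<kappa> \<mu> g)"
    using Hs_add(2)[OF w' h(1)] by metis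
  then show ?case
    using Suc h(2) by (simp add: w_def g_def)
qed simp

text \<open>The equation \<open>c\<^sub>0 \<kappa>\<^sup>k = 2 |\<mu>|\<close> makes \<open>\<mu>\<close> dominate the symbol on frequencies well below \<open>\<kappa>\<close>, so that
  \<open>w\<close> lives on frequencies \<open>\<gtrsim> \<kappa>\<close>, where the \<open>H\<^sup>s\<close> norm gains a factor \<open>\<kappa>\<^bsup>s - p\<^esup>\<close> over the \<open>H\<^sup>p\<close> norm.\<close>

lemma frequency_concentration:
  assumes s: "real p \<le> s" and c0: "0 < c0" and \<kappa>: "1 \<le> \<kappa>" "16 * CL \<le> c0 * \<kappa>"
    and \<mu>: "c0 * \<kappa> ^ k = 2 * cmod \<mu>"
    and L1_0: "L1 w \<in> Hs 0" "hn 0 (L1 w) \<le> CL * hn (real p) w"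
    and \<sigma>_le: "\<And>m. cmod (\<sigma> m) \<le> Cs * br m ^ k" and \<beta>: "0 < \<beta>" "\<beta> \<le> 1" "Cs * \<beta> ^ k \<le> c0 / 4" "0 < Cs"
    and w: "w \<in> Hs s" and F: "F \<in> Hs (real p - real k)"
    and eq: "\<And>m. br m < \<kappa> \<Longrightarrow> (\<mu> - \<sigma> m) * w m - L1 w m = F m"
  shows "hn (real p) w \<le> hn (real p) w / 4 + 4 / c0 * hn (real p - real k) F + (\<beta> * \<kappa>) powr (real p - s) * hn s w"
proof -
  define low where "low = {m. br m < \<beta> * \<kappa>}"
  have \<kappa>0: "0 < \<kappa>"
    using \<kappa> by simp
  have low: "br m < \<kappa>" "\<mu> - \<sigma> m \<noteq> 0" "1 / cmod (\<mu> - \<sigma> m) \<le> 4 / (c0 * \<kappa> ^ k)" if "m \<in> low" for m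
  proof -
    have m: "br m < \<beta> * \<kappa>"
      using that by (simp add: low_def)
    also have "\<dots> \<le> 1 * \<kappa>"
      using \<beta> \<kappa>0 by (intro mult_right_mono) auto
    finally show "br m < \<kappa>"
      by simp
    \<comment> \<open>Here \<open>|\<mu>|\<close> is half of \<open>c0 * \<kappa> ^ k\<close> and
      the symbol is at most a quarter of it, which leaves a quarter as lower bound for the
      difference.\<close>
    have "cmod (\<sigma> m) \<le> Cs * (\<beta> * \<kappa>) ^ k"
      using m \<beta> by (intro order_trans[OF \<sigma>_le] mult_left_mono power_mono) auto
    also have "\<dots> \<le> c0 / 4 * \<kappa> ^ k"
      using \<beta>(3) \<kappa>0 by (simp add: power_mult_distrib mult.assoc[symmetric])
    finally have *: "c0 * \<kappa> ^ k / 4 \<le> cmod (\<mu> - \<sigma> m)"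
      using \<mu> norm_triangle_ineq2[of \<mu> "\<sigma> m"] by linarith
    have **: "0 < c0 * \<kappa> ^ k / 4"
      using c0 \<kappa>0 by simp
    then show "\<mu> - \<sigma> m \<noteq> 0"
      using * by auto
    have "1 / cmod (\<mu> - \<sigma> m) \<le> 1 / (c0 * \<kappa> ^ k / 4)"
      using * ** by (intro divide_left_mono mult_pos_pos) auto
    then show "1 / cmod (\<mu> - \<sigma> m) \<le> 4 / (c0 * \<kappa> ^ k)"
      by simp
  qed
  \<comment> \<open>At low frequencies the equation is solved for \<open>w\<close>: \<open>x\<close>
    is the contribution of \<open>F\<close> and \<open>y\<close> that of \<open>L1 w\<close>. The
    remaining piece \<open>z\<close> is \<open>w\<close> at frequencies at least
    \<open>\<beta> * \<kappa>\<close>.\<close>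
  define x where "x m = (if m \<in> low then F m / (\<mu> - \<sigma> m) else 0)" for m
  define y where "y m = (if m \<in> low then L1 w m / (\<mu> - \<sigma> m) else 0)" for m
  define z where "z m = (if m \<in> low then 0 else w m)" for m
  have "cmod (x m) * br m powr real p \<le> 4 / c0 * (cmod (F m) * br m powr (real p - real k))" for m
  proof (cases "m \<in> low")
    case True
    have "br m ^ k \<le> \<kappa> ^ k"
      using low(1)[OF True] by (intro power_mono) auto
    then have "4 / (c0 * \<kappa> ^ k) \<le> 4 / (c0 * br m ^ k)"
      using c0 \<kappa>0 by (intro divide_left_mono mult_left_mono mult_pos_pos) auto
    then have "1 / cmod (\<mu> - \<sigma> m) \<le> 4 / (c0 * br m ^ k)"
      using low(3)[OF True] by linarith
    then have "1 / cmod (\<mu> - \<sigma> m) * (cmod (F m) * br m powr real p)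
        \<le> 4 / (c0 * br m ^ k) * (cmod (F m) * br m powr real p)"
      by (rule mult_right_mono) simp
    then show ?thesis
      using True by (simp add: x_def norm_divide powr_diff powr_realpow)
  qed (use c0 in \<open>simp add: x_def\<close>)
  from Hs_compare[OF F _ this] have x: "x \<in> Hs (real p)" "hn (real p) x \<le> 4 / c0 * hn (real p - real k) F"
    using c0 by auto
  have "cmod (y m) * br m powr real p \<le> 4 / (c0 * \<kappa>) * (cmod (L1 w m) * br m powr 0)" for m
  proof (cases "m \<in> low")
    case True
    \<comment> \<open>Because \<open>p + 1 \<le> k\<close>, dividing by \<open>\<kappa> ^ k\<close>
      pays for the \<open>p\<close> derivatives and leaves a factor \<open>1 / \<kappa>\<close>, by
      which \<open>y\<close> is absorbed into a quarter of \<open>w\<close>.\<close>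
    have "br m ^ p * \<kappa> \<le> \<kappa> ^ p * \<kappa>"
      using low(1)[OF True] \<kappa>0 by (intro mult_right_mono power_mono) auto
    also have "\<dots> = \<kappa> ^ Suc p"
      by simp
    also have "\<dots> \<le> \<kappa> ^ k"
      using \<kappa> p_less_k by (intro power_increasing) auto
    finally have "4 / (c0 * \<kappa> ^ k) * br m ^ p \<le> 4 / (c0 * \<kappa>)"
      using c0 \<kappa>0 by (simp add: field_simps)
    moreover have "1 / cmod (\<mu> - \<sigma> m) * br m ^ p \<le> 4 / (c0 * \<kappa> ^ k) * br m ^ p"
      using low(3)[OF True] by (rule mult_right_mono) simp
    ultimately have "1 / cmod (\<mu> - \<sigma> m) * br m ^ p \<le> 4 / (c0 * \<kappa>)"
      by linarith
    then have "1 / cmod (\<mu> - \<sigma> m) * br m ^ p * cmod (L1 w m) \<le> 4 / (c0 * \<kappa>) * cmod (L1 w m)"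
      by (rule mult_right_mono) simp
    then show ?thesis
      using True by (simp add: y_def norm_divide powr_realpow mult_ac)
  qed (use c0 \<kappa>0 in \<open>simp add: y_def\<close>)
  from Hs_compare[OF L1_0(1) _ this]
  have y: "y \<in> Hs (real p)" "hn (real p) y \<le> 4 / (c0 * \<kappa>) * hn 0 (L1 w)"
    using c0 \<kappa>0 by auto
  note y(2)
  also have "4 / (c0 * \<kappa>) * hn 0 (L1 w) \<le> 4 / (c0 * \<kappa>) * (CL * hn (real p) w)"
    using c0 \<kappa>0 L1_0(2) by (intro mult_left_mono) auto
  also have "\<dots> = 4 * CL / (c0 * \<kappa>) * hn (real p) w"
    by simp
  also have "\<dots> \<le> 1 / 4 * hn (real p) w"
    using c0 \<kappa>0 \<kappa>(2) by (intro mult_right_mono) (auto simp: field_simps)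
  finally have y': "hn (real p) y \<le> hn (real p) w / 4"
    by simp
  have "cmod (z m) * br m powr real p \<le> (\<beta> * \<kappa>) powr (real p - s) * (cmod (w m) * br m powr s)" for m
  proof (cases "m \<in> low")
    case False
    have "br m powr real p = br m powr (real p - s) * br m powr s"
      by (simp add: powr_add[symmetric])
    also have "\<dots> \<le> (\<beta> * \<kappa>) powr (real p - s) * br m powr s"
      using False \<beta> \<kappa>0 s by (intro mult_right_mono powr_mono2') (auto simp: low_def)
    finally have "cmod (w m) * br m powr real p \<le> cmod (w m) * ((\<beta> * \<kappa>) powr (real p - s) * br m powr s)"
      by (rule mult_left_mono) simp
    then show ?thesis
      using False by (simp add: z_def mult_ac)
  qed (simp add: z_def)
  from Hs_compare[OF w _ this]
  have z: "z \<in> Hs (real p)" "hn (real p) z \<le> (\<beta> * \<kappa>) powr (real p - s) * hn s w"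
    by auto
  have "w = (\<lambda>m. x m + y m + z m)"
  proof
    fix m
    show "w m = x m + y m + z m"
    proof (cases "m \<in> low")
      case True
      have "F m + L1 w m = (\<mu> - \<sigma> m) * w m"
        using eq[OF low(1)[OF True]] by (simp add: algebra_simps)
      then show ?thesis
        using True low(2)[OF True] by (simp add: x_def y_def z_def add_divide_distrib[symmetric])
    qed (simp add: x_def y_def z_def)
  qed
  then have "hn (real p) w \<le> hn (real p) x + hn (real p) y + hn (real p) z"
    using Hs_add[OF Hs_add(1)[OF x(1) y(1)] z(1)] Hs_add(2)[OF x(1) y(1)] by simp
  then show ?thesis
    using x(2) y' z(2) by linarith
qed

text \<open>After enough corrections the residual is a term of order \<open>s - k\<close> plus a
  part below \<open>\<kappa>\<close>, where passing from order \<open>p - k\<close> to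
  \<open>s - k\<close> costs \<open>\<kappa> powr (s - p)\<close>. Frequency concentration of the
  corrected function recovers this factor, so \<open>D\<close> is independent of
  \<open>\<mu>\<close>.\<close>

lemma pseudomode:
  assumes s: "real p \<le> s" "s - real k \<le> r"
  obtains D where "0 < D"
    "\<And>N u \<mu>. 1 \<le> N \<Longrightarrow> PN N u = u \<Longrightarrow> u \<noteq> (\<lambda>_. 0) \<Longrightarrow>
      (\<And>m. (\<mu> - \<sigma> m) * u m - L1 u m = - QN N (L1 u) m) \<Longrightarrow>
      \<exists>w\<in>Hs s. w \<noteq> (\<lambda>_. 0) \<and>
        hn (s - real k) (\<lambda>m. (\<mu> - \<sigma> m) * w m - L1 w m) \<le> D * real N powr (real p - real k) * hn s w"
proof -
  have k1: "1 \<le> k"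
    using p_less_k by simp
  obtain c R where c: "0 < c" "1 \<le> R" "\<And>m. R \<le> br m \<Longrightarrow> c * br m ^ k \<le> cmod (\<sigma> m)"
    using symb_lower[of cc k q] lead q_le_k k1 by metis
  obtain Cs where Cs: "0 < Cs" "\<And>m. cmod (\<sigma> m) \<le> Cs * br m ^ k"
    using symb_upper by metis
  obtain CL where CL: "0 < CL" "\<And>v. v \<in> Hs (real p) \<Longrightarrow> L1 v \<in> Hs 0"
    "\<And>v. v \<in> Hs (real p) \<Longrightarrow> hn 0 (L1 v) \<le> CL * hn (real p) v"
    using L1op_bounded[OF coeffs r_ge_1, of 0] by auto
  obtain CR where CR: "0 < CR" "\<And>v. v \<in> Hs (r + real p) \<Longrightarrow> L1 v \<in> Hs r"
    "\<And>v. v \<in> Hs (r + real p) \<Longrightarrow> hn r (L1 v) \<le> CR * hn (r + real p) v"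
    using L1op_bounded[OF coeffs r_ge_1, of r] r_ge_1 by auto
  obtain CE where CE: "0 < CE"
    "\<And>N u. 1 \<le> N \<Longrightarrow> PN N u = u \<Longrightarrow> QN N (L1 u) \<in> Hs (real p - real k)"
    "\<And>N u. 1 \<le> N \<Longrightarrow> PN N u = u \<Longrightarrow>
      hn (real p - real k) (QN N (L1 u)) \<le> CE * real N powr (real p - real k) * hn (real p) u"
    using truncation_residual[OF coeffs r_ge_1 p_less_k order_refl] by blast
  define c1 where "c1 = c / 2"
  have c1: "0 < c1"
    using c by (simp add: c1_def)
  \<comment> \<open>The first step reaches order 0 and each further one gains
    \<open>k - p \<ge> 1\<close> up to the cap \<open>r \<ge> s - k\<close>; this many steps reach
    order \<open>s - k\<close>.\<close>
  define n where "n = Suc (nat \<lceil>max 0 (s - real k)\<rceil>)"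
  have n: "s - real k \<le> res_order n"
  proof -
    define i where "i = nat \<lceil>max 0 (s - real k)\<rceil>"
    have "s - real k \<le> real i"
      unfolding i_def by linarith
    also have "\<dots> \<le> real i * (real k - real p)"
      using k_minus_p by (simp add: mult_le_cancel_left1)
    finally show ?thesis
      using s(2) by (simp add: n_def i_def)
  qed
  obtain Cr where Cr: "\<And>i. 0 \<le> Cr i" "\<And>i \<kappa> \<mu> f. elliptic_above c1 \<kappa> \<mu> \<Longrightarrow> f \<in> Hs (real p - real k) \<Longrightarrow>
    residual \<kappa> \<mu> f i \<in> Hs (res_order i) \<and>
    hn (res_order i) (residual \<kappa> \<mu> f i) \<le> Cr i * hn (real p - real k) f"
    using residual_bound[OF c1] by metis
  define T where "T = 1 + (\<Sum>i<Suc n. Cr i)"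
  have T: "1 \<le> T" "(\<Sum>i<Suc n. Cr i) \<le> T"
    using sum_nonneg[of "{..<Suc n}" Cr] Cr(1) by (auto simp: T_def)
  \<comment> \<open>A floor for \<open>\<kappa>\<close>: above it the leading term controls the
    symbol, and \<open>L1\<close> is a small perturbation at low frequencies. The number
    \<open>\<beta>\<close> is chosen so that the symbol below \<open>\<beta> * \<kappa>\<close> is
    at most a quarter of \<open>c * \<kappa> ^ k\<close>.\<close>
  define K where "K = max R (16 * CL / c)"
  define \<beta> where "\<beta> = min 1 (c / (4 * Cs))"
  have \<beta>: "0 < \<beta>" "\<beta> \<le> 1" "Cs * \<beta> ^ k \<le> c / 4"
  proof -
    show "0 < \<beta>" "\<beta> \<le> 1"
      using c Cs by (auto simp: \<beta>_def)
    then have "\<beta> ^ k \<le> \<beta> ^ 1"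
      using k1 by (intro power_decreasing) auto
    also have "\<dots> \<le> c / (4 * Cs)"
      by (simp add: \<beta>_def)
    finally show "Cs * \<beta> ^ k \<le> c / 4"
      using Cs(1) by (simp add: field_simps)
  qed
  have K: "1 \<le> K" "R \<le> K" "16 * CL \<le> c * K"
  proof -
    show "1 \<le> K" "R \<le> K"
      using c by (auto simp: K_def)
    have "16 * CL / c \<le> K"
      by (simp add: K_def)
    then show "16 * CL \<le> c * K"
      using c by (simp add: field_simps)
  qed
  \<comment> \<open>The first summand is the loss when \<open>\<kappa>\<close> is determined by
    \<open>\<mu>\<close>, the second the loss when \<open>\<kappa>\<close> equals the floor
    \<open>K\<close>.\<close>
  define G where "G = 2 * \<beta> powr (real p - s) + K powr (s - real p)"
  define D1 where "D1 = 2 * T * CE * G"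
  \<comment> \<open>Beyond \<open>N1\<close> the residual satisfies
    \<open>T * E \<le> c / 32 * U\<close>; the 32 leaves \<open>U / 16\<close> in \<open>UW\<close>
    and \<open>U / 8\<close> in \<open>conc\<close>. Smaller \<open>N\<close> are covered by
    \<open>D2\<close>.\<close>
  define N1 where "N1 = 1 + 32 * T * CE / c"
  define D2 where "D2 = CR * N1 powr (r + real k)"
  have N1: "1 \<le> N1"
    using T CE c by (simp add: N1_def)
  have G: "0 < G"
    using K \<beta> by (auto simp: G_def intro!: add_pos_pos)
  show ?thesis
  proof (rule that[of "D1 + D2"])
    show "0 < D1 + D2"
      using T CE G CR N1 by (auto simp: D1_def D2_def intro!: add_pos_pos)
    fix N u \<mu>
    assume N: "1 \<le> N" and u: "PN N u = u" "u \<noteq> (\<lambda>_. 0)"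
      and eq: "\<And>m. (\<mu> - \<sigma> m) * u m - L1 u m = - QN N (L1 u) m"
    define f where "f = (\<lambda>m. - QN N (L1 u) m)"
    define U where "U = hn (real p) u"
    define E where "E = hn (real p - real k) f"
    define Np where "Np = real N powr (real p - real k)"
    have uH: "u \<in> Hs t" for t
      by (rule PN_fixed_Hs[OF u(1)])
    have f: "f \<in> Hs r" "hn r f \<le> CR * hn (r + real p) u"
    proof -
      have v: "L1 u \<in> Hs r" "hn r (L1 u) \<le> CR * hn (r + real p) u"
        using CR uH by auto
      have "QN N (L1 u) \<in> Hs r" "hn r (QN N (L1 u)) \<le> hn r (L1 u)"
        using QN_Hs[OF v(1) order_refl N] N by auto
      then show "f \<in> Hs r" "hn r f \<le> CR * hn (r + real p) u"
        using Hs_cmult[of "QN N (L1 u)" r "-1"] v(2) by (auto simp: f_def)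
    qed
    have E: "f \<in> Hs (real p - real k)" "E \<le> CE * Np * U"
      using Hs_cmult[OF CE(2)[OF N u(1)], of "-1"] CE(3)[OF N u(1)]
      by (auto simp: f_def E_def U_def Np_def)
    have U: "0 < U"
      using hn_pos[OF uH u(2)] by (simp add: U_def)
    have fs: "f \<in> Hs (s - real k)" "hn (s - real k) f \<le> hn r f"
      using Hs_mono[OF f(1) s(2)] by auto
    have Np0: "0 < Np"
      using N by (simp add: Np_def)
    have D1: "0 < D1" and D2: "0 < D2"
      using T CE G CR N1 by (auto simp: D1_def D2_def)
    show "\<exists>w\<in>Hs s. w \<noteq> (\<lambda>_. 0) \<and>
        hn (s - real k) (\<lambda>m. (\<mu> - \<sigma> m) * w m - L1 w m) \<le> (D1 + D2) * real N powr (real p - real k) * hn s w"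
    proof (cases "real N \<le> N1")
      case True
      \<comment> \<open>For bounded \<open>N\<close> the eigenvector itself serves: all powers of
        \<open>N\<close> are bounded in terms of \<open>N1\<close>.\<close>
      have "hn (s - real k) f \<le> CR * hn (r + real p) u"
        using fs(2) f(2) by linarith
      also have "\<dots> \<le> CR * (real N powr (r + real p) * hn 0 u)"
        using PN_fixed_inverse_inequality[OF u(1) N, of 0 "r + real p"] r_ge_1 CR(1)
        by (intro mult_left_mono) auto
      also have "\<dots> \<le> CR * (N1 powr (r + real p) * hn s u)"
        using True CR(1) r_ge_1 s Hs_mono(2)[OF uH, of 0 s]
        by (intro mult_left_mono mult_mono powr_mono2) auto
      also have "\<dots> \<le> CR * (N1 powr (r + real p) * (N1 powr (real k - real p) * Np * hn s u))"
      proof (intro mult_left_mono)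
        have "N1 powr (real p - real k) \<le> Np"
          unfolding Np_def using True N p_less_k by (intro powr_mono2') auto
        then have "N1 powr (real k - real p) * N1 powr (real p - real k) \<le> N1 powr (real k - real p) * Np"
          by (rule mult_left_mono) simp
        then have "1 \<le> N1 powr (real k - real p) * Np"
          using N1 by (simp add: powr_add[symmetric])
        then show "hn s u \<le> N1 powr (real k - real p) * Np * hn s u"
          using mult_right_mono[of 1 _ "hn s u"] by simp
      qed (use CR in auto)
      also have "\<dots> = CR * (N1 powr (r + real p) * N1 powr (real k - real p)) * Np * hn s u"
        by simp
      also have "N1 powr (r + real p) * N1 powr (real k - real p) = N1 powr (r + real k)"
        by (simp add: powr_add[symmetric])
      also have "CR * N1 powr (r + real k) * Np * hn s u \<le> (D1 + D2) * Np * hn s u"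
        using D1 Np0 by (intro mult_right_mono) (auto simp: D2_def)
      finally show ?thesis
        using uH u(2) by (intro bexI[of _ u]) (auto simp: eq f_def Np_def)
    next
      case False
      \<comment> \<open>The root of \<open>c * \<kappa> ^ k = 2 * |\<mu>|\<close>, raised to
        \<open>K\<close> if necessary. Either way \<open>|\<mu>|\<close> is at most half of
        \<open>c * \<kappa> ^ k\<close>, so half of the ellipticity constant survives above
        \<open>\<kappa>\<close>.\<close>
      define \<kappa> where "\<kappa> = max K ((2 * cmod \<mu> / c) powr (1 / real k))"
      have \<kappa>: "K \<le> \<kappa>" "1 \<le> \<kappa>"
        using K by (auto simp: \<kappa>_def)
      \<comment> \<open>For \<open>\<mu> = 0\<close> both sides vanish, since
        \<open>0 powr x = 0\<close> and \<open>k \<ge> 1\<close>.\<close>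
      have root: "((2 * cmod \<mu> / c) powr (1 / real k)) ^ k = 2 * cmod \<mu> / c"
        using k1 c by (cases "\<mu> = 0") (auto simp: powr_realpow[symmetric] powr_powr zero_power)
      have \<mu>: "2 * cmod \<mu> \<le> c * \<kappa> ^ k"
      proof -
        have "((2 * cmod \<mu> / c) powr (1 / real k)) ^ k \<le> \<kappa> ^ k"
          by (intro power_mono) (auto simp: \<kappa>_def)
        then have "2 * cmod \<mu> / c \<le> \<kappa> ^ k"
          by (simp only: root)
        then show ?thesis
          using c by (simp add: field_simps)
      qed
      have el: "elliptic_above c1 \<kappa> \<mu>"
        unfolding elliptic_above_def
      proof (intro allI impI)
        fix m assume m: "\<kappa> \<le> br m"
        have "c * \<kappa> ^ k \<le> c * br m ^ k"
          using m \<kappa> c by (intro mult_left_mono power_mono) auto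
        moreover have "c * br m ^ k \<le> cmod (\<sigma> m)"
          using m \<kappa> K by (intro c) auto
        ultimately show "c1 * br m ^ k \<le> cmod (\<mu> - \<sigma> m)"
          using \<mu> norm_triangle_ineq2[of "\<sigma> m" \<mu>] by (simp add: c1_def norm_minus_commute)
      qed
      define w where "w = corrected \<kappa> \<mu> f u n"
      define W where "W = hn (real p) w"
      define g where "g = residual \<kappa> \<mu> f"
      have wH: "w \<in> Hs s"
        using Hs_mono(1)[OF corrected_Hs[OF c1 el f(1) uH], of s n] s by (simp add: w_def)
      have wHp: "w \<in> Hs (real p)"
        using Hs_mono(1)[OF wH s(1)] .
      have h: "(\<mu> - \<sigma> m) * w m - L1 w m = g n m + (if br m < \<kappa> then \<Sum>i<n. g i m else 0)" for m
        unfolding w_def g_def using corrected_residual[OF c1 el f(1) uH] eq by (simp add: f_def)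
      have g: "g i \<in> Hs (res_order i)" "hn (res_order i) (g i) \<le> Cr i * E" for i
        using Cr(2)[OF el E(1)] by (auto simp: g_def E_def)
      have gp: "g i \<in> Hs (real p - real k)" "hn (real p - real k) (g i) \<le> Cr i * E" for i
        using Hs_mono[OF g(1) res_order_ge] g(2)[of i] order_trans by blast+
      have E0: "0 \<le> E"
        by (simp add: E_def)
      have sum_g: "(\<lambda>m. \<Sum>i<j. g i m) \<in> Hs (real p - real k)"
        "hn (real p - real k) (\<lambda>m. \<Sum>i<j. g i m) \<le> (\<Sum>i<j. Cr i) * E" for j
      proof -
        have "(\<lambda>m. \<Sum>i<j. g i m) \<in> Hs (real p - real k) \<and>
            hn (real p - real k) (\<lambda>m. \<Sum>i<j. g i m) \<le> (\<Sum>i<j. hn (real p - real k) (g i))"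
          using gp(1) by (intro Hs_sum) auto
        moreover have "(\<Sum>i<j. hn (real p - real k) (g i)) \<le> (\<Sum>i<j. Cr i) * E"
          unfolding sum_distrib_right by (intro sum_mono gp(2))
        ultimately show "(\<lambda>m. \<Sum>i<j. g i m) \<in> Hs (real p - real k)"
          "hn (real p - real k) (\<lambda>m. \<Sum>i<j. g i m) \<le> (\<Sum>i<j. Cr i) * E"
          by auto
      qed
      have TE: "T * E \<le> c / 32 * U"
      proof -
        have "Np \<le> real N powr (-1)"
          unfolding Np_def using N k_minus_p by (intro powr_mono) auto
        also have "\<dots> = 1 / real N"
          using N by (simp add: powr_minus_divide)
        finally have "Np * real N \<le> 1"
          using N by (simp add: field_simps)
        moreover have "32 * T * CE / c \<le> real N"
          using False by (simp add: N1_def)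
        ultimately have "Np * (32 * T * CE / c) \<le> 1"
          using mult_left_mono[of "32 * T * CE / c" "real N" Np] Np0 by linarith
        then have "T * (CE * Np) \<le> c / 32"
          using c by (simp add: field_simps)
        then have "T * (CE * Np) * U \<le> c / 32 * U"
          using U by (intro mult_right_mono) auto
        moreover have "T * E \<le> T * (CE * Np * U)"
          using E(2) T by (intro mult_left_mono) auto
        ultimately show ?thesis
          by (simp add: mult.assoc)
      qed
      \<comment> \<open>The corrections amount to at most \<open>U / 16\<close>, so \<open>w\<close>
        keeps at least half of the \<open>Hs p\<close> norm of \<open>u\<close>; in particular it is
        nonzero.\<close>
      have UW: "U \<le> 2 * W"
      proof -
        have "(\<Sum>i<n. 1 / c1 * hn (real p - real k) (g i)) \<le> (\<Sum>i<n. 1 / c1 * (Cr i * E))"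
          using c1 gp(2) by (intro sum_mono mult_left_mono) auto
        also have "\<dots> = 1 / c1 * ((\<Sum>i<n. Cr i) * E)"
          by (simp add: sum_distrib_left sum_distrib_right)
        also have "\<dots> \<le> 1 / c1 * (T * E)"
          using T Cr(1)[of n] E0 c1 by (intro mult_left_mono mult_right_mono) auto
        also have "\<dots> \<le> 1 / c1 * (c / 32 * U)"
          using TE c1 by (intro mult_left_mono) auto
        also have "\<dots> = U / 16"
          using c by (simp add: c1_def)
        finally show ?thesis
          using corrected_norm[OF c1 el f(1) uH, of n] U by (simp add: U_def W_def w_def g_def)
      qed
      have W: "0 < W"
        using U UW by linarith
      then have w0: "w \<noteq> (\<lambda>_. 0)"
        by (auto simp: W_def)
      \<comment> \<open>If \<open>\<kappa> = K\<close>, the factor is a constant. Otherwise the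
        equation linking \<open>\<kappa>\<close> and \<open>\<mu>\<close> holds exactly, as
        \<open>frequency_concentration\<close> requires.\<close>
      have conc: "\<kappa> powr (s - real p) * W \<le> G * hn s w"
      proof (cases "\<kappa> = K")
        case True
        have "K powr (s - real p) * W \<le> K powr (s - real p) * hn s w"
          using Hs_mono(2)[OF wH s(1)] by (intro mult_left_mono) (auto simp: W_def)
        also have "\<dots> \<le> G * hn s w"
          by (intro mult_right_mono) (auto simp: G_def)
        finally show ?thesis
          using True by simp
      next
        case False
        then have "\<kappa> = (2 * cmod \<mu> / c) powr (1 / real k)"
          by (simp add: \<kappa>_def max_def split: if_splits)
        then have "\<kappa> ^ k = 2 * cmod \<mu> / c"
          using root by simp
        then have \<mu>_eq: "c * \<kappa> ^ k = 2 * cmod \<mu>"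
          using c by simp
        have "c * K \<le> c * \<kappa>"
          using \<kappa> c by (intro mult_left_mono) auto
        then have CL\<kappa>: "16 * CL \<le> c * \<kappa>"
          using K by linarith
        have "(\<mu> - \<sigma> m) * w m - L1 w m = (\<Sum>i<Suc n. g i m)" if "br m < \<kappa>" for m
          using h[of m] that by simp
        from frequency_concentration[OF s(1) c(1) \<kappa>(2) CL\<kappa> \<mu>_eq CL(2,3)[OF wHp] Cs(2) \<beta> Cs(1) wH sum_g(1) this]
        have "W \<le> W / 4 + 4 / c * hn (real p - real k) (\<lambda>m. \<Sum>i<Suc n. g i m) + (\<beta> * \<kappa>) powr (real p - s) * hn s w"
          by (simp only: W_def)
        moreover have "4 / c * hn (real p - real k) (\<lambda>m. \<Sum>i<Suc n. g i m) \<le> 4 / c * (T * E)"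
          using sum_g(2)[of "Suc n"] mult_right_mono[OF T(2) E0] c by (intro mult_left_mono) auto
        moreover have "4 / c * (T * E) \<le> 4 / c * (c / 32 * U)"
          using TE c by (intro mult_left_mono) auto
        moreover have "4 / c * (c / 32 * U) = U / 8"
          using c by simp
        ultimately have "W / 2 \<le> (\<beta> * \<kappa>) powr (real p - s) * hn s w"
          using UW by linarith
        then have "\<kappa> powr (s - real p) * (W / 2) \<le> \<kappa> powr (s - real p) * ((\<beta> * \<kappa>) powr (real p - s) * hn s w)"
          by (rule mult_left_mono) simp
        also have "\<dots> = (\<kappa> powr (s - real p) * \<kappa> powr (real p - s)) * \<beta> powr (real p - s) * hn s w"
          by (simp add: powr_mult)
        also have "\<kappa> powr (s - real p) * \<kappa> powr (real p - s) = 1"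
          using \<kappa> by (simp add: powr_add[symmetric])
        finally have "\<kappa> powr (s - real p) * W \<le> 2 * \<beta> powr (real p - s) * hn s w"
          by simp
        also have "\<dots> \<le> G * hn s w"
          by (intro mult_right_mono) (auto simp: G_def)
        finally show ?thesis .
      qed
      have \<kappa>s: "1 \<le> \<kappa> powr (s - real p)"
        using \<kappa> s by (simp add: ge_one_powr_ge_zero)
      \<comment> \<open>The uncancelled low-frequency part of the residual; its change of order
        costs exactly the factor in \<open>conc\<close>.\<close>
      define x where "x m = (if br m < \<kappa> then \<Sum>i<n. g i m else 0)" for m
      have "cmod (x m) * br m powr (s - real k) \<le>
          \<kappa> powr (s - real p) * (cmod (\<Sum>i<n. g i m) * br m powr (real p - real k))" for m
      proof (cases "br m < \<kappa>")
        case True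
        have "br m powr (s - real k) = br m powr (s - real p) * br m powr (real p - real k)"
          by (simp add: powr_add[symmetric])
        also have "\<dots> \<le> \<kappa> powr (s - real p) * br m powr (real p - real k)"
          using True s by (intro mult_right_mono powr_mono2) auto
        finally have "cmod (\<Sum>i<n. g i m) * br m powr (s - real k) \<le>
            cmod (\<Sum>i<n. g i m) * (\<kappa> powr (s - real p) * br m powr (real p - real k))"
          by (rule mult_left_mono) simp
        then show ?thesis
          using True by (simp add: x_def mult_ac)
      qed (simp add: x_def)
      from Hs_compare[OF sum_g(1) _ this]
      have x: "x \<in> Hs (s - real k)" "hn (s - real k) x \<le> \<kappa> powr (s - real p) * hn (real p - real k) (\<lambda>m. \<Sum>i<n. g i m)"
        by auto
      have gn: "g n \<in> Hs (s - real k)" "hn (s - real k) (g n) \<le> Cr n * E"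
        using Hs_mono[OF g(1) n] g(2)[of n] by auto
      have "hn (s - real k) (\<lambda>m. (\<mu> - \<sigma> m) * w m - L1 w m) \<le> hn (s - real k) (g n) + hn (s - real k) x"
        using Hs_add(2)[OF gn(1) x(1)] by (simp add: h x_def)
      also have "\<dots> \<le> \<kappa> powr (s - real p) * (Cr n * E) + \<kappa> powr (s - real p) * ((\<Sum>i<n. Cr i) * E)"
      proof (rule add_mono)
        have "0 \<le> Cr n * E"
          using Cr(1) E0 by simp
        then show "hn (s - real k) (g n) \<le> \<kappa> powr (s - real p) * (Cr n * E)"
          using gn(2) mult_right_mono[OF \<kappa>s, of "Cr n * E"] by simp
        show "hn (s - real k) x \<le> \<kappa> powr (s - real p) * ((\<Sum>i<n. Cr i) * E)"
          using x(2) mult_left_mono[OF sum_g(2), of "\<kappa> powr (s - real p)" n] by simp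
      qed
      also have "\<dots> = \<kappa> powr (s - real p) * ((\<Sum>i<Suc n. Cr i) * E)"
        by (simp add: algebra_simps)
      also have "\<dots> \<le> \<kappa> powr (s - real p) * (T * (CE * Np * (2 * W)))"
      proof (intro mult_left_mono mult_mono T(2))
        have "CE * Np * U \<le> CE * Np * (2 * W)"
          using UW CE(1) Np0 by (intro mult_left_mono) auto
        then show "E \<le> CE * Np * (2 * W)"
          using E(2) by linarith
      qed (use E0 T in auto)
      also have "\<dots> = 2 * T * CE * Np * (\<kappa> powr (s - real p) * W)"
        by simp
      also have "\<dots> \<le> 2 * T * CE * Np * (G * hn s w)"
        using T CE(1) Np0 by (intro mult_left_mono conc) auto
      also have "\<dots> = D1 * Np * hn s w"
        by (simp add: D1_def)
      also have "\<dots> \<le> (D1 + D2) * Np * hn s w"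
        using D2 Np0 by (intro mult_right_mono) auto
      finally show ?thesis
        using wH w0 by (intro bexI[of _ w]) (auto simp: Np_def)
    qed
  qed
qed

end

section \<open>Smoothness of the coefficients recovered from the mapping property\<close>

lemma Hs_translate:
  assumes "u \<in> Hs t" "0 \<le> t"
  shows "(\<lambda>m. u (m + n)) \<in> Hs t"
proof -
  define C where "C = 2 powr t * (br n powr t + 1)"
  have C: "0 \<le> C"
    by (simp add: C_def)
  have wt: "br m powr t \<le> C * br (m + n) powr t" for m
  proof -
    have "br m powr t \<le> 2 powr t * (br (m - (m + n)) powr t + br (m + n) powr t)"
      by (rule br_powr_triangle[OF assms(2)])
    also have "br (m - (m + n)) = br n"
      by (simp add: br_def)
    also have "br n powr t \<le> br n powr t * br (m + n) powr t"
      using assms(2) by (simp add: ge_one_powr_ge_zero)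
    finally show ?thesis
      by (simp add: C_def algebra_simps)
  qed
  have wt': "cmod (u (m + n)) * br m powr t \<le> C * (cmod (u (m + n)) * br (m + n) powr t)" for m
    using mult_left_mono[OF wt[of m], of "cmod (u (m + n))"] by (simp add: mult_ac)
  have "L2_set (\<lambda>m. cmod (u (m + n)) * br m powr t) F \<le> C * hn t u" for F
  proof -
    have "L2_set (\<lambda>m. cmod (u (m + n)) * br m powr t) F \<le>
        L2_set (\<lambda>m. C * (cmod (u (m + n)) * br (m + n) powr t)) F"
      by (intro L2_set_mono wt') auto
    also have "\<dots> = C * L2_set (\<lambda>m. cmod (u (m + n)) * br (m + n) powr t) F"
      using C by (simp add: L2_set_right_distrib)
    also have "L2_set (\<lambda>m. cmod (u (m + n)) * br (m + n) powr t) F =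
        L2_set (\<lambda>m. cmod (u m) * br m powr t) ((\<lambda>m. m + n) ` F)"
      unfolding L2_set_def by (subst sum.reindex) (auto simp: inj_on_def)
    also have "C * \<dots> \<le> C * hn t u"
      by (intro mult_left_mono L2_set_le_hn assms C)
    finally show ?thesis .
  qed
  then show ?thesis
    by (rule Hs_bound(1))
qed

text \<open>Polynomial interpolation with sequence-valued coefficients. Dividing the difference from
  the value at one point \<open>x0\<close> by \<open>x - x0\<close> lowers the degree; an infinite
  \<open>X\<close> stays infinite when \<open>x0\<close> is removed, so the induction can
  continue.\<close>

lemma Hs_coeffs_from_values:
  assumes "infinite X" "\<And>x. x \<in> X \<Longrightarrow> (\<lambda>m. \<Sum>j\<le>p. b j m * x ^ j) \<in> Hs t" "j \<le> p"
  shows "b j \<in> Hs t"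
  using assms
proof (induction p arbitrary: b X j)
  case 0
  then obtain x where "x \<in> X"
    using infinite_imp_nonempty by blast
  then show ?case
    using 0 by (simp add: fun_eq_iff)
next
  case (Suc n)
  obtain x0 where x0: "x0 \<in> X"
    using Suc.prems(1) infinite_imp_nonempty by blast
  \<comment> \<open>The coefficients of the quotient in synthetic division by
    \<open>x - x0\<close>.\<close>
  define d where "d j m = (\<Sum>i=Suc j..Suc n. b i m * x0 ^ (i - j - 1))" for j m
  have d: "d j \<in> Hs t" if "j \<le> n" for j
  proof (rule Suc.IH[of "X - {x0}", OF _ _ that])
    fix x assume x: "x \<in> X - {x0}"
    have "(\<Sum>i\<le>Suc n. b i m * x ^ i) - (\<Sum>i\<le>Suc n. b i m * x0 ^ i) =
        (x - x0) * (\<Sum>j\<le>n. d j m * x ^ j)" for m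
      unfolding sub_polyfun d_def lessThan_Suc_atMost sum_distrib_right by simp
    then have "(\<Sum>j\<le>n. d j m * x ^ j) =
        1 / (x - x0) * ((\<Sum>i\<le>Suc n. b i m * x ^ i) - (\<Sum>i\<le>Suc n. b i m * x0 ^ i))" for m
      using x by (simp del: sum.atMost_Suc)
    moreover have "(\<lambda>m. 1 / (x - x0) * ((\<Sum>i\<le>Suc n. b i m * x ^ i) - (\<Sum>i\<le>Suc n. b i m * x0 ^ i))) \<in> Hs t"
      using x x0 by (intro Hs_cmult(1) Hs_diff(1) Suc.prems(2)) auto
    ultimately show "(\<lambda>m. \<Sum>j\<le>n. d j m * x ^ j) \<in> Hs t"
      by simp
  qed (use Suc.prems in auto)
  have pos: "b (Suc i) \<in> Hs t" if "i \<le> n" for i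
  proof (cases "i = n")
    case True
    have "b (Suc i) = d n"
      by (auto simp: d_def True fun_eq_iff)
    then show ?thesis
      using d by simp
  next
    case False
    \<comment> \<open>Horner's recursion, read backwards to recover \<open>b\<close> from
      \<open>d\<close>.\<close>
    have "d i m = b (Suc i) m + x0 * d (Suc i) m" for m
    proof -
      have "d i m = b (Suc i) m + (\<Sum>l=Suc (Suc i)..Suc n. b l m * x0 ^ (l - i - 1))"
        using that unfolding d_def by (subst sum.atLeast_Suc_atMost) auto
      also have "(\<Sum>l=Suc (Suc i)..Suc n. b l m * x0 ^ (l - i - 1)) =
          (\<Sum>l=Suc (Suc i)..Suc n. x0 * (b l m * x0 ^ (l - Suc i - 1)))"
      proof (rule sum.cong)
        fix l assume "l \<in> {Suc (Suc i)..Suc n}"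
        then have "l - i - 1 = Suc (l - Suc i - 1)"
          by auto
        then show "b l m * x0 ^ (l - i - 1) = x0 * (b l m * x0 ^ (l - Suc i - 1))"
          by (simp only: power_Suc mult_ac)
      qed simp
      finally show ?thesis
        by (simp only: d_def sum_distrib_left)
    qed
    then have "b (Suc i) = (\<lambda>m. d i m - x0 * d (Suc i) m)"
      by auto
    then show ?thesis
      using that False by (auto intro!: Hs_diff(1) Hs_cmult(1) d)
  qed
  show ?case
  proof (cases j)
    case 0
    have "(\<lambda>m. (\<Sum>i\<le>Suc n. b i m * x0 ^ i) - (\<Sum>i\<le>n. x0 ^ Suc i * b (Suc i) m)) \<in> Hs t"
    proof (intro Hs_diff(1) Suc.prems(2) x0)
      show "(\<lambda>m. \<Sum>i\<le>n. x0 ^ Suc i * b (Suc i) m) \<in> Hs t"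
        using Hs_sum[of "{..n}" "\<lambda>i m. x0 ^ Suc i * b (Suc i) m" t] pos by (auto intro: Hs_cmult(1))
    qed
    moreover have "(\<Sum>i\<le>Suc n. b i m * x0 ^ i) - (\<Sum>i\<le>n. x0 ^ Suc i * b (Suc i) m) = b 0 m" for m
      by (subst sum.atMost_Suc_shift) (simp add: mult_ac)
    ultimately show ?thesis
      by (simp add: 0)
  next
    case (Suc i)
    then show ?thesis
      using pos Suc.prems(3) by simp
  qed
qed

lemma cmul_finite_support:
  assumes "finite F" "\<And>n. n \<notin> F \<Longrightarrow> v n = 0"
  shows "cmul b v m = (\<Sum>n\<in>F. b (m - n) * v n)"
proof -
  have "cmul b v m = (\<Sum>\<^sub>\<infinity>n\<in>F. b (m - n) * v n)"
    unfolding cmul_def using assms(2) by (intro infsum_cong_neutral) auto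
  then show ?thesis
    using assms(1) by simp
qed

text \<open>The matrix of \<open>L1op\<close> in the Fourier basis. It is used both to test single
  modes and to write the truncated operator as a matrix.\<close>

lemma L1op_finite_support:
  assumes "finite F" "\<And>n. n \<notin> F \<Longrightarrow> u n = 0"
  shows "L1op p a u m = (\<Sum>n\<in>F. (\<Sum>j\<le>p. a j (m - n) * (\<i> * of_int n) ^ j) * u n)"
proof -
  have "cmul (a j) (dth j u) m = (\<Sum>n\<in>F. a j (m - n) * dth j u n)" for j
    using assms by (intro cmul_finite_support) (auto simp: dth_def)
  then have "L1op p a u m = (\<Sum>j\<le>p. \<Sum>n\<in>F. a j (m - n) * dth j u n)"
    by (simp add: L1op_def atLeast0AtMost)
  also have "\<dots> = (\<Sum>n\<in>F. (\<Sum>j\<le>p. a j (m - n) * (\<i> * of_int n) ^ j) * u n)"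
    by (subst sum.swap) (simp add: dth_def sum_distrib_right mult.assoc)
  finally show ?thesis .
qed

lemma shift_op_Lop_eq:
  "shift_op \<mu> (Lop q k cc p a) u = (\<lambda>m. (\<mu> - symb q k cc m) * u m - L1op p a u m)"
  by (auto simp: shift_op_def Lop_def L0op_eq algebra_simps)

text \<open>Applied to the mode of frequency \<open>n\<close>, the perturbation gives the polynomial
  with coefficients \<open>a j\<close> at \<open>\<i> * n\<close>, shifted by \<open>n\<close>.
  Undoing the shift and varying \<open>n\<close> over all integers separates the
  coefficients.\<close>

lemma coeffs_in_Hs_if_maps:
  assumes "0 \<le> t" "\<And>u. u \<in> Hs s \<Longrightarrow> shift_op \<mu> (Lop q k cc p a) u \<in> Hs t" "j \<le> p"
  shows "a j \<in> Hs t"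
proof (rule Hs_coeffs_from_values[of "range (\<lambda>n::int. \<i> * of_int n)"])
  show "infinite (range (\<lambda>n::int. \<i> * of_int n))"
    using infinite_UNIV_int by (subst finite_image_iff) (auto simp: inj_on_def)
  fix x assume "x \<in> range (\<lambda>n::int. \<i> * of_int n)"
  then obtain n :: int where x: "x = \<i> * of_int n"
    by auto
  define e where "e m = (if m = n then 1 else 0 :: complex)" for m
  have L: "L1op p a e m = (\<Sum>j\<le>p. a j (m - n) * x ^ j)" for m
    using L1op_finite_support[of "{n}" e p a m] by (simp add: e_def x)
  have e: "e \<in> Hs s" and e': "(\<lambda>m. (\<mu> - symb q k cc m) * e m) \<in> Hs t"
    by (auto intro!: finite_support_Hs[of "{n}"] simp: e_def split: if_splits)
  have "(\<lambda>m. (\<mu> - symb q k cc m) * e m - shift_op \<mu> (Lop q k cc p a) e m) \<in> Hs t"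
    by (intro Hs_diff(1) e' assms(2) e)
  then have "L1op p a e \<in> Hs t"
    by (simp add: shift_op_Lop_eq)
  from Hs_translate[OF this assms(1), of n]
  show "(\<lambda>m. \<Sum>j\<le>p. a j m * x ^ j) \<in> Hs t"
    by (simp add: L)
qed (use assms in auto)

text \<open>For \<open>s \<le> p\<close> the truncated eigenvector itself is a pseudomode. For \<open>s > p\<close> the operator \<open>L\<^sub>1\<close> need not
  map \<open>H\<^sup>s\<close> to \<open>H\<^bsup>s-p\<^esup>\<close> (for instance if \<open>\<ell> < s - p\<close>), and a corrected eigenvector takes its place.\<close>

lemma ex_pseudomode:
  assumes "p < k" "q \<le> k" "cc k \<noteq> 0" "\<forall>j\<le>p. a j \<in> Hs r" "1 \<le> r"
  obtains D where "0 < D"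
    "\<And>N \<mu>. 1 \<le> N \<Longrightarrow> eig_trunc q k cc p a N \<mu> \<Longrightarrow>
      bij_betw (shift_op \<mu> (Lop q k cc p a)) (Hs s) (Hs (s - real k)) \<Longrightarrow>
      \<exists>w\<in>Hs s. w \<noteq> (\<lambda>_. 0) \<and> hn (s - real k) (shift_op \<mu> (Lop q k cc p a) w)
        \<le> D * real N powr (real p - real k) * hn s w"
proof (cases "s \<le> real p")
  case True
  obtain C where C: "0 < C"
    "\<And>N u. 1 \<le> N \<Longrightarrow> PN N u = u \<Longrightarrow> QN N (L1op p a u) \<in> Hs (s - real k)"
    "\<And>N u. 1 \<le> N \<Longrightarrow> PN N u = u \<Longrightarrow>
      hn (s - real k) (QN N (L1op p a u)) \<le> C * real N powr (real p - real k) * hn s u"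
    using truncation_residual[OF assms(4,5,1) True] by blast
  show ?thesis
  proof (rule that[OF C(1)])
    fix N \<mu> assume N: "1 \<le> N" and "eig_trunc q k cc p a N \<mu>"
    then obtain u where u: "u \<noteq> (\<lambda>_. 0)" "PN N u = u"
      "(\<lambda>m. L0op q k cc u m + PN N (L1op p a u) m) = (\<lambda>m. \<mu> * u m)"
      by (auto simp: eig_trunc_def)
    show "\<exists>w\<in>Hs s. w \<noteq> (\<lambda>_. 0) \<and> hn (s - real k) (shift_op \<mu> (Lop q k cc p a) w)
        \<le> C * real N powr (real p - real k) * hn s w"
      using u PN_fixed_Hs[OF u(2), of s] C(3)[OF N u(2)]
        Hs_cmult(2)[OF C(2)[OF N u(2)], of "-1"]
      by (intro bexI[of _ u]) (auto simp: eigen_residual[OF u(3)])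
  qed
next
  case False
  show ?thesis
  proof (cases "\<forall>j\<le>p. a j \<in> Hs (max r (s - real k))")
    case True
    interpret perturbed_symbol k p q cc a "max r (s - real k)"
      using assms True by unfold_locales auto
    obtain D where D: "0 < D"
      "\<And>N u \<mu>. 1 \<le> N \<Longrightarrow> PN N u = u \<Longrightarrow> u \<noteq> (\<lambda>_. 0) \<Longrightarrow>
        (\<And>m. (\<mu> - symb q k cc m) * u m - L1op p a u m = - QN N (L1op p a u) m) \<Longrightarrow>
        \<exists>w\<in>Hs s. w \<noteq> (\<lambda>_. 0) \<and>
          hn (s - real k) (\<lambda>m. (\<mu> - symb q k cc m) * w m - L1op p a w m)
            \<le> D * real N powr (real p - real k) * hn s w"
      using pseudomode[of s] False by auto
    show ?thesis
    proof (rule that[OF D(1)])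
      fix N \<mu> assume N: "1 \<le> N" and "eig_trunc q k cc p a N \<mu>"
      then obtain u where u: "u \<noteq> (\<lambda>_. 0)" "PN N u = u"
        "(\<lambda>m. L0op q k cc u m + PN N (L1op p a u) m) = (\<lambda>m. \<mu> * u m)"
        by (auto simp: eig_trunc_def)
      show "\<exists>w\<in>Hs s. w \<noteq> (\<lambda>_. 0) \<and> hn (s - real k) (shift_op \<mu> (Lop q k cc p a) w)
          \<le> D * real N powr (real p - real k) * hn s w"
        unfolding shift_op_Lop_eq
        by (rule D(2)[OF N u(2,1)]) (rule fun_cong[OF eigen_residual[OF u(3), unfolded shift_op_Lop_eq]])
    qed
  next
    case False
    then obtain j where j: "j \<le> p" "a j \<notin> Hs (max r (s - real k))"
      by blast
    then have t: "r \<le> s - real k" "a j \<notin> Hs (s - real k)"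
      using assms(4) by (auto simp: max_def split: if_splits)
    \<comment> \<open>Some coefficient is too rough for the operator to map into
      \<open>Hs (s - k)\<close> at all; the bijectivity premise fails and any positive
      \<open>D\<close> will do.\<close>
    have "\<not> bij_betw (shift_op \<mu> (Lop q k cc p a)) (Hs s) (Hs (s - real k))" for \<mu>
      using coeffs_in_Hs_if_maps[of "s - real k" s \<mu> q k cc p a j] t j(1) assms(5)
      by (auto dest: bij_betwE)
    then show ?thesis
      using that[of 1] by simp
  qed
qed

lemma eig_trunc_notin_pseudores:
  assumes "p < k" "q \<le> k" "cc k \<noteq> 0" "\<forall>j\<le>p. a j \<in> Hs r" "1 \<le> r" "\<forall>r\<ge>0. 0 < cn r"
  shows "\<exists>c. \<forall>\<epsilon>>0. \<forall>N. 1 \<le> N \<and> c * \<epsilon> powr (1 / (real p - real k)) < real N \<longrightarrow>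
    (\<forall>\<mu>. eig_trunc q k cc p a N \<mu> \<longrightarrow>
      \<mu> \<notin> pseudores (Lop q k cc p a) (Hs s) (hnorm cn s) (Hs (s - real k)) (hnorm cn (s - real k)) \<epsilon>)"
proof -
  obtain D where D: "0 < D"
    "\<And>N \<mu>. 1 \<le> N \<Longrightarrow> eig_trunc q k cc p a N \<mu> \<Longrightarrow>
      bij_betw (shift_op \<mu> (Lop q k cc p a)) (Hs s) (Hs (s - real k)) \<Longrightarrow>
      \<exists>w\<in>Hs s. w \<noteq> (\<lambda>_. 0) \<and> hn (s - real k) (shift_op \<mu> (Lop q k cc p a) w)
        \<le> D * real N powr (real p - real k) * hn s w"
    using ex_pseudomode[of p k q cc a r s] assms(1-5) by blast
  define A B where "A = sqrt (cn \<bar>s\<bar>)" and "B = sqrt (cn \<bar>s - real k\<bar>)"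
  have AB: "0 < A" "0 < B"
    using assms(6) by (auto simp: A_def B_def)
  define D' where "D' = D * B / A"
  have D': "0 < D'"
    using D(1) AB by (simp add: D'_def)
  \<comment> \<open>Obtained by solving \<open>D' * N powr (p - k) < \<epsilon>\<close> for
    \<open>N\<close>. The strict inequality places \<open>\<mu>\<close> in the superlevel set
    itself, before taking the closure.\<close>
  define c where "c = D' powr (1 / (real k - real p))"
  have c: "0 < c"
    using D' by (simp add: c_def)
  have pk: "real p - real k < 0"
    using assms(1) by simp
  show ?thesis
  proof (intro exI[of _ c] allI impI)
    fix \<epsilon> :: real and N \<mu>
    assume \<epsilon>: "0 < \<epsilon>" and N: "1 \<le> N \<and> c * \<epsilon> powr (1 / (real p - real k)) < real N"
      and eig: "eig_trunc q k cc p a N \<mu>"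
    let ?T = "shift_op \<mu> (Lop q k cc p a)"
    define X where "X = D' * real N powr (real p - real k)"
    have X: "0 < X"
      using D' N by (simp add: X_def)
    have "real N powr (real p - real k) < (c * \<epsilon> powr (1 / (real p - real k))) powr (real p - real k)"
      using N c \<epsilon> pk by (intro powr_less_mono2_neg) auto
    also have "\<dots> = D' powr ((real p - real k) / (real k - real p)) * \<epsilon>"
      using \<epsilon> pk D' by (simp add: powr_mult powr_powr c_def)
    also have "(real p - real k) / (real k - real p) = -1"
      using pk by (simp add: field_simps)
    finally have "X < \<epsilon>"
      using D' by (simp add: X_def powr_minus field_simps)
    then have "ereal (1 / \<epsilon>) < ereal (1 / X)"
      using X \<epsilon> by (simp add: field_simps)
    also have "\<dots> \<le> inv_opnorm ?T (Hs s) (hnorm cn s) (Hs (s - real k)) (hnorm cn (s - real k))"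
    proof (cases "bij_betw ?T (Hs s) (Hs (s - real k))")
      case True
      then obtain w where w: "w \<in> Hs s" "w \<noteq> (\<lambda>_. 0)" "hn (s - real k) (?T w)
        \<le> D * real N powr (real p - real k) * hn s w"
        using D(2) N eig by blast
      show ?thesis
      proof (rule inv_opnorm_ge[of ?T _ w])
        show "hnorm cn (s - real k) (?T w) \<le> X * hnorm cn s w"
          using mult_left_mono[OF w(3), of B] AB
          by (simp add: hnorm_eq_hn A_def[symmetric] B_def[symmetric] X_def D'_def mult_ac)
        show "0 < hnorm cn (s - real k) v" if "v \<in> Hs (s - real k)" "v \<noteq> (\<lambda>_. 0)" for v
          using hn_pos[OF that] AB by (simp add: hnorm_eq_hn B_def[symmetric])
      qed (use w X in auto)
    qed (simp add: inv_opnorm_def)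
    finally have "\<mu> \<in> pseudospec (Lop q k cc p a) (Hs s) (hnorm cn s) (Hs (s - real k)) (hnorm cn (s - real k)) \<epsilon>"
      unfolding pseudospec_def by (intro closure_subset[THEN subsetD] CollectI)
    then show "\<mu> \<notin> pseudores (Lop q k cc p a) (Hs s) (hnorm cn s) (Hs (s - real k)) (hnorm cn (s - real k)) \<epsilon>"
      by (simp add: pseudores_def)
  qed
qed

section \<open>Eigenvalues of the truncation near an eigenvalue\<close>

text \<open>The Leibniz formula is a polynomial in the entries.\<close>

lemma holomorphic_on_det:
  assumes "\<And>i j. i < n \<Longrightarrow> j < n \<Longrightarrow> (\<lambda>z. f z i j) holomorphic_on S"
  shows "(\<lambda>z. Determinant.det (Matrix.mat n n (\<lambda>(i, j). f z i j))) holomorphic_on S"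
proof -
  have lt: "p i < n" if "p permutes {0..<n}" "i < n" for p i
    using permutes_in_image[OF that(1), of i] that(2) by simp
  have "Determinant.det (Matrix.mat n n (\<lambda>(i, j). f z i j)) =
      (\<Sum>p\<in>{p. p permutes {0..<n}}. signof p * (\<Prod>i=0..<n. f z i (p i)))" for z
    by (subst det_def'[of _ n]) (auto intro!: sum.cong prod.cong simp: lt)
  moreover have "(\<lambda>z. \<Sum>p\<in>{p. p permutes {0..<n}}. signof p * (\<Prod>i=0..<n. f z i (p i))) holomorphic_on S"
    using assms by (intro holomorphic_intros) (auto simp: lt)
  ultimately show ?thesis
    by simp
qed

text \<open>By \<open>inj\<close> there is no eigenvalue in the closed disc, so the
  \<open>m\<close>-th coordinate of the resolvent applied to \<open>g\<close> is a scalar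
  holomorphic function there. Its value at the centre is \<open>\<phi> m\<close>, and the maximum
  modulus principle carries the bound over from the circle.\<close>

lemma resolvent_coordinate_bound:
  fixes A :: "'i \<Rightarrow> 'i \<Rightarrow> complex" and g \<phi> :: "'i \<Rightarrow> complex"
  assumes fin: "finite F" and "m \<in> F" and "0 < d"
    and inj: "\<And>z u. z \<in> cball lam d \<Longrightarrow> (\<And>i. i \<in> F \<Longrightarrow> (\<Sum>j\<in>F. A i j * u j) = z * u i) \<Longrightarrow>
      (\<And>i. i \<in> F \<Longrightarrow> u i = 0)"
    and \<phi>: "\<And>i. i \<in> F \<Longrightarrow> lam * \<phi> i - (\<Sum>j\<in>F. A i j * \<phi> j) = g i"
    and bound: "\<And>z y. z \<in> sphere lam d \<Longrightarrow> (\<And>i. i \<in> F \<Longrightarrow> z * y i - (\<Sum>j\<in>F. A i j * y j) = g i) \<Longrightarrow>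
      cmod (y m) \<le> B"
  shows "cmod (\<phi> m) \<le> B"
proof -
  define n where "n = card F"
  obtain e where e: "bij_betw e {0..<n} F"
    using ex_bij_betw_nat_finite[OF fin] n_def by blast
  obtain l where l: "l < n" "e l = m"
    using e \<open>m \<in> F\<close> by (metis atLeastLessThan_iff bij_betw_iff_bijections)
  have ex_e: "\<exists>i'<n. i = e i'" if "i \<in> F" for i
    using e that by (auto simp: bij_betw_def)
  have eF: "e i \<in> F" if "i < n" for i
    using e that by (auto dest: bij_betwE)
  define M where "M z = Matrix.mat n n (\<lambda>(i, j). (if i = j then z else 0) - A (e i) (e j))" for z
  have M: "M z \<in> carrier_mat n n" for z
    by (simp add: M_def)
  define V where "V y = Matrix.vec n (\<lambda>i. y (e i))" for y :: "'i \<Rightarrow> complex"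
  have V: "V y \<in> carrier_vec n" for y
    by (simp add: V_def)
  have MV: "vec_index (M z *\<^sub>v V y) i = z * y (e i) - (\<Sum>j\<in>F. A (e i) j * y j)" if "i < n" for z y i
  proof -
    have "vec_index (M z *\<^sub>v V y) i = (\<Sum>j=0..<n. ((if i = j then z else 0) - A (e i) (e j)) * y (e j))"
      using that by (simp add: M_def V_def scalar_prod_def)
    also have "\<dots> = (\<Sum>j=0..<n. (if i = j then z * y (e i) else 0)) - (\<Sum>j=0..<n. A (e i) (e j) * y (e j))"
      by (subst sum_subtractf[symmetric]) (auto intro!: sum.cong simp: left_diff_distrib)
    also have "(\<Sum>j=0..<n. A (e i) (e j) * y (e j)) = (\<Sum>j\<in>F. A (e i) j * y j)"
      using sum.reindex_bij_betw[OF e] by fast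
    finally show ?thesis
      using that by simp
  qed
  have repr: "\<exists>y. v = V y" if "v \<in> carrier_vec n" for v
  proof -
    define y where "y x = vec_index v (inv_into {0..<n} e x)" for x
    have "v = V y"
      using that e by (intro eq_vecI) (auto simp: V_def y_def bij_betw_def)
    then show ?thesis
      by blast
  qed
  have nz: "Determinant.det (M z) \<noteq> 0" if z: "z \<in> cball lam d" for z
  proof
    assume "Determinant.det (M z) = 0"
    then obtain v where v: "v \<in> carrier_vec n" "v \<noteq> 0\<^sub>v n" "M z *\<^sub>v v = 0\<^sub>v n"
      using det_0_iff_vec_prod_zero_field[OF M] by blast
    then obtain y where y: "v = V y"
      using repr by blast
    have "(\<Sum>j\<in>F. A i j * y j) = z * y i" if "i \<in> F" for i
    proof -
      obtain i' where "i' < n" "i = e i'"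
        using ex_e[OF \<open>i \<in> F\<close>] by blast
      then show ?thesis
        using MV[of i' z y] v(3) y by simp
    qed
    from inj[OF z this] have "v = 0\<^sub>v n"
      using eF by (intro eq_vecI) (auto simp: y V_def)
    then show False
      using v by simp
  qed
  \<comment> \<open>Cramer's rule makes holomorphy visible: a quotient of determinants with entries
    affine in \<open>z\<close>.\<close>
  define h where "h z = Determinant.det (replace_col (M z) (V g) l) / Determinant.det (M z)" for z
  have cramer: "h z = y m" if "z \<in> cball lam d" "M z *\<^sub>v V y = V g" for z y
  proof -
    have "Determinant.det (replace_col (M z) (M z *\<^sub>v V y) l) = vec_index (V y) l * Determinant.det (M z)"
      by (rule cramer_lemma_mat[OF M V l(1)])
    then show ?thesis
      using that nz[of z] l by (simp add: h_def V_def)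
  qed
  have "h holomorphic_on cball lam d"
  proof -
    have R: "replace_col (M z) (V g) l =
        Matrix.mat n n (\<lambda>(i, j). if j = l then g (e i) else (if i = j then z else 0) - A (e i) (e j))" for z
      by (intro eq_matI) (auto simp: replace_col_def M_def V_def)
    have entry: "(\<lambda>z. (if i = j then z else 0) - A (e i) (e j)) holomorphic_on cball lam d" for i j
      by (cases "i = j") (auto intro!: holomorphic_intros)
    then have "(\<lambda>z. if j = l then g (e i) else (if i = j then z else 0) - A (e i) (e j))
        holomorphic_on cball lam d" for i j
      by (cases "j = l") auto
    from holomorphic_on_det[OF this, of n]
    have "(\<lambda>z. Determinant.det (replace_col (M z) (V g) l)) holomorphic_on cball lam d"
      by (simp only: R)
    moreover have "(\<lambda>z. Determinant.det (M z)) holomorphic_on cball lam d"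
      unfolding M_def by (rule holomorphic_on_det[OF entry])
    ultimately show ?thesis
      unfolding h_def using nz by (intro holomorphic_on_divide) auto
  qed
  then have hol: "h holomorphic_on interior (cball lam d)" and cont: "continuous_on (closure (cball lam d)) h"
    by (auto intro: holomorphic_on_subset holomorphic_on_imp_continuous_on)
  have hb: "cmod (h z) \<le> B" if z: "z \<in> frontier (cball lam d)" for z
  proof -
    have zc: "z \<in> cball lam d" "z \<in> sphere lam d"
      using z \<open>0 < d\<close> by auto
    \<comment> \<open>The hypothesis \<open>bound\<close> speaks about solutions, so one must exist
      on the circle; the nonzero determinant provides a right inverse.\<close>
    have "\<exists>X\<in>carrier_mat n n. M z * X = 1\<^sub>m n"
      using det_non_zero_imp_unit[OF M nz[OF zc(1)], of "()"]
      unfolding Units_def ring_mat_def by auto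
    then obtain X where X: "X \<in> carrier_mat n n" "M z * X = 1\<^sub>m n"
      by blast
    have "X *\<^sub>v V g \<in> carrier_vec n"
      using X V by simp
    then obtain y where y: "X *\<^sub>v V g = V y"
      using repr by blast
    have My: "M z *\<^sub>v V y = V g"
      using X V[of g] M[of z] by (simp flip: y add: assoc_mult_mat_vec[symmetric, of _ n n _ n])
    have "cmod (y m) \<le> B"
    proof (rule bound[OF zc(2)])
      fix i assume "i \<in> F"
      then obtain i' where "i' < n" "i = e i'"
        using ex_e by blast
      then show "z * y i - (\<Sum>j\<in>F. A i j * y j) = g i"
        using MV[of i' z y] My by (simp add: V_def)
    qed
    then show ?thesis
      using cramer[OF zc(1) My] by simp
  qed
  have lc: "lam \<in> cball lam d"
    using \<open>0 < d\<close> by simp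
  have "M lam *\<^sub>v V \<phi> = V g"
    using MV[of _ lam \<phi>] \<phi> eF M[of lam] by (intro eq_vecI) (auto simp: V_def)
  then have "h lam = \<phi> m"
    by (rule cramer[OF lc])
  then show ?thesis
    using maximum_modulus_frontier[OF hol cont bounded_cball hb lc] by simp
qed

text \<open>It suffices to watch one coordinate \<open>m0\<close> where \<open>\<phi>\<close> does
  not vanish. Were the disc free of eigenvalues, the smallness on the circle would bound this
  coordinate by half of itself.\<close>

lemma ex_eig_trunc_near:
  assumes "p < k" "q \<le> k" "cc k \<noteq> 0" "\<forall>j\<le>p. a j \<in> Hs r" "1 \<le> r" "\<forall>m. \<zeta> \<noteq> symb q k cc m"
    and \<phi>: "\<phi> \<in> Hs (real k)" "\<phi> \<noteq> (\<lambda>_. 0)" "Lop q k cc p a \<phi> = (\<lambda>m. lam * \<phi> m)"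
  obtains \<eta> N0 where "0 < \<eta>"
    "\<And>N d. N0 \<le> N \<Longrightarrow> 0 < d \<Longrightarrow>
      (\<And>z u. z \<in> sphere lam d \<Longrightarrow> PN N u = u \<Longrightarrow>
        hn 0 u * real N powr (real p - real k) \<le> \<eta> * hn 0 (IK q k cc p a \<zeta> z u)) \<Longrightarrow>
      \<exists>lamN. eig_trunc q k cc p a N lamN \<and> cmod (lam - lamN) \<le> d"
proof -
  let ?\<sigma> = "symb q k cc" and ?L1 = "L1op p a"
  obtain c where c: "0 < c" "\<And>m. c * br m ^ k \<le> cmod (?\<sigma> m - \<zeta>)"
    using symb_shift_lower[of cc k q \<zeta>] assms(1-3,6) by auto
  obtain CL where CL: "0 < CL" "\<And>v. v \<in> Hs (real p) \<Longrightarrow> ?L1 v \<in> Hs 0"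
    "\<And>v. v \<in> Hs (real p) \<Longrightarrow> hn 0 (?L1 v) \<le> CL * hn (real p) v"
    using L1op_bounded[OF assms(4,5), of 0] by auto
  obtain CE where CE: "0 < CE"
    "\<And>N u. 1 \<le> N \<Longrightarrow> PN N u = u \<Longrightarrow> QN N (?L1 u) \<in> Hs (0 - real k)"
    "\<And>N u. 1 \<le> N \<Longrightarrow> PN N u = u \<Longrightarrow>
      hn (0 - real k) (QN N (?L1 u)) \<le> CE * real N powr (real p - real k) * hn 0 u"
    using truncation_residual[OF assms(4,5,1), of 0] by auto
  obtain m0 where m0: "\<phi> m0 \<noteq> 0"
    using \<phi>(2) by auto
  \<comment> \<open>Up to the factor \<open>N powr (p - k)\<close>, \<open>P\<close> bounds
    \<open>Nop\<close> applied to the truncation error \<open>g\<close> of \<open>\<phi>\<close>;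
    the added 1 makes it positive. \<open>Q\<close> does the same for the residual of
    \<open>v\<close>, relative to the norm of \<open>v\<close>.\<close>
  define P where "P = 1 + 1 / c * (CL * (2 powr (real k - real p) * hn (real k) \<phi>))"
  define Q where "Q = 1 / c * CE"
  have P: "0 < P" and Q: "0 < Q"
    using c CL CE by (auto simp: P_def Q_def intro!: add_pos_nonneg)
  \<comment> \<open>The first bound absorbs the \<open>Q\<close> term into half of the norm of
    \<open>v\<close>; the second leaves a quarter of \<open>cmod (\<phi> m0)\<close>, hence one half
    in total.\<close>
  define \<eta> where "\<eta> = min (1 / (2 * Q)) (cmod (\<phi> m0) / (4 * P))"
  have \<eta>: "0 < \<eta>" "\<eta> * Q \<le> 1 / 2" "\<eta> * P \<le> cmod (\<phi> m0) / 4"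
  proof -
    show "0 < \<eta>"
      using P Q m0 by (simp add: \<eta>_def)
    have "\<eta> \<le> 1 / (2 * Q)" "\<eta> \<le> cmod (\<phi> m0) / (4 * P)"
      by (auto simp: \<eta>_def)
    then show "\<eta> * Q \<le> 1 / 2" "\<eta> * P \<le> cmod (\<phi> m0) / 4"
      using P Q by (auto simp: field_simps)
  qed
  have \<phi>p: "\<phi> \<in> Hs (real p)"
    using Hs_mono(1)[OF \<phi>(1)] assms(1) by simp
  show ?thesis
  \<comment> \<open>This threshold puts \<open>m0\<close> among the retained frequencies despite
    their asymmetric range.\<close>
  proof (rule that[OF \<eta>(1), of "2 * nat \<bar>m0\<bar> + 2"])
    fix N and d :: real
    assume N0: "2 * nat \<bar>m0\<bar> + 2 \<le> N" and d: "0 < d"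
      and bound: "\<And>z u. z \<in> sphere lam d \<Longrightarrow> PN N u = u \<Longrightarrow>
        hn 0 u * real N powr (real p - real k) \<le> \<eta> * hn 0 (IK q k cc p a \<zeta> z u)"
    have N: "1 \<le> N"
      using N0 by simp
    have m0F: "m0 \<in> freqs N"
      using N0 unfolding freqs_def atLeastAtMost_iff by linarith
    define Np where "Np = real N powr (real p - real k)"
    have Np: "0 < Np"
      using N by (simp add: Np_def)
    define A where "A i j = (if i = j then ?\<sigma> i else 0) + (\<Sum>l\<le>p. a l (i - j) * (\<i> * of_int j) ^ l)" for i j
    define g where "g = PN N (?L1 (QN N \<phi>))"
    have A: "(\<Sum>j\<in>freqs N. A i j * u j) = ?\<sigma> i * u i + ?L1 (PN N u) i" if "i \<in> freqs N" for i u
    proof -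
      have "?L1 (PN N u) i = (\<Sum>j\<in>freqs N. (\<Sum>l\<le>p. a l (i - j) * (\<i> * of_int j) ^ l) * PN N u j)"
        by (rule L1op_finite_support) (auto simp: PN_eq)
      also have "\<dots> = (\<Sum>j\<in>freqs N. (\<Sum>l\<le>p. a l (i - j) * (\<i> * of_int j) ^ l) * u j)"
        by (intro sum.cong) (auto simp: PN_eq)
      finally have "(\<Sum>j\<in>freqs N. A i j * u j) =
          (\<Sum>j\<in>freqs N. (if i = j then ?\<sigma> i * u i else 0)) + ?L1 (PN N u) i"
        by (simp only: A_def distrib_right sum.distrib if_distrib[of "\<lambda>x. x * _"] mult_zero_left)
          (auto intro!: sum.cong)
      then show ?thesis
        using that by simp
    qed
    have PP: "PN N (PN N u) = PN N u" for u
      by (auto simp: PN_eq)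
    show "\<exists>lamN. eig_trunc q k cc p a N lamN \<and> cmod (lam - lamN) \<le> d"
    proof (rule ccontr)
      assume none: "\<not> (\<exists>lamN. eig_trunc q k cc p a N lamN \<and> cmod (lam - lamN) \<le> d)"
      have "cmod (\<phi> m0) \<le> cmod (\<phi> m0) / 2"
      proof (rule resolvent_coordinate_bound[where F = "freqs N" and A = A and g = g, OF finite_freqs m0F d])
        fix z u i
        assume z: "z \<in> cball lam d" and i: "i \<in> freqs N"
          and u: "\<And>i. i \<in> freqs N \<Longrightarrow> (\<Sum>j\<in>freqs N. A i j * u j) = z * u i"
        have "(\<lambda>m. L0op q k cc (PN N u) m + PN N (?L1 (PN N u)) m) = (\<lambda>m. z * PN N u m)"
          using u A by (auto simp: L0op_eq PN_eq)
        moreover have "cmod (lam - z) \<le> d"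
          using z by (simp add: dist_norm)
        ultimately have "PN N u = (\<lambda>_. 0)"
          using none PP unfolding eig_trunc_def by blast
        then show "u i = 0"
          using i by (metis PN_eq)
      next
        fix i assume i: "i \<in> freqs N"
        have "lam * \<phi> i = ?\<sigma> i * \<phi> i + ?L1 \<phi> i"
          using fun_cong[OF \<phi>(3), of i] by (simp add: Lop_def L0op_eq)
        moreover have "?L1 (QN N \<phi>) i = ?L1 \<phi> i - ?L1 (PN N \<phi>) i"
          unfolding QN_def by (rule L1op_diff[OF assms(4,5) \<phi>p PN_Hs(1)[OF \<phi>p]])
        ultimately show "lam * \<phi> i - (\<Sum>j\<in>freqs N. A i j * \<phi> j) = g i"
          unfolding A[OF i] using i by (simp add: g_def PN_eq)
      next
        fix z y
        assume z: "z \<in> sphere lam d"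
          and y: "\<And>i. i \<in> freqs N \<Longrightarrow> z * y i - (\<Sum>j\<in>freqs N. A i j * y j) = g i"
        define v where "v = PN N y"
        have v: "PN N v = v"
          by (simp add: v_def PP)
        have y': "z * y i - (?\<sigma> i * y i + ?L1 v i) = g i" if "i \<in> freqs N" for i
          using y[OF that] A[OF that] by (simp add: v_def)
        \<comment> \<open>On retained frequencies \<open>L v - z v\<close> is \<open>- g\<close>;
          elsewhere \<open>v\<close> vanishes and only \<open>L1 v\<close> remains. Applying
          \<open>Nop\<close> gives the two terms.\<close>
        have IK_eq: "IK q k cc p a \<zeta> z v = (\<lambda>m. Nop q k cc \<zeta> (QN N (?L1 v)) m - Nop q k cc \<zeta> g m)"
        proof
          fix m
          show "IK q k cc p a \<zeta> z v m = Nop q k cc \<zeta> (QN N (?L1 v)) m - Nop q k cc \<zeta> g m"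
          proof (cases "m \<in> freqs N")
            case True
            have "?\<sigma> m * v m + ?L1 v m - z * v m = - g m"
              unfolding y'[OF True, symmetric] using True by (simp add: v_def PN_eq)
            then show ?thesis
              using True by (simp add: IK_def Nop_def Lop_def L0op_eq QN_eq)
          next
            case False
            then have "v m = 0" "g m = 0"
              by (auto simp: v_def g_def PN_eq)
            then show ?thesis
              using False by (simp add: IK_def Nop_def Lop_def L0op_eq QN_eq)
          qed
        qed
        have Qv: "Nop q k cc \<zeta> (QN N (?L1 v)) \<in> Hs 0" "hn 0 (Nop q k cc \<zeta> (QN N (?L1 v))) \<le> Q * Np * hn 0 v"
        proof -
          have "hn (0 - real k + real k) (Nop q k cc \<zeta> (QN N (?L1 v))) \<le> 1 / c * (CE * Np * hn 0 v)"
            unfolding Np_def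
            by (rule order_trans[OF Nop_Hs(2)[OF c CE(2)[OF N v]] mult_left_mono[OF CE(3)[OF N v]]])
              (use c(1) in simp)
          then show "hn 0 (Nop q k cc \<zeta> (QN N (?L1 v))) \<le> Q * Np * hn 0 v"
            by (simp add: Q_def)
          show "Nop q k cc \<zeta> (QN N (?L1 v)) \<in> Hs 0"
            using Nop_Hs(1)[OF c CE(2)[OF N v]] by simp
        qed
        have Q\<phi>: "QN N \<phi> \<in> Hs (real p)" "hn (real p) (QN N \<phi>) \<le> 2 powr (real k - real p) * Np * hn (real k) \<phi>"
          using QN_Hs[OF \<phi>(1), of "real p" N] assms(1) N by (auto simp: Np_def)
        have g: "g \<in> Hs 0" "hn 0 g \<le> CL * (2 powr (real k - real p) * Np * hn (real k) \<phi>)"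
        proof -
          show "g \<in> Hs 0"
            unfolding g_def by (intro PN_Hs(1) CL(2) Q\<phi>(1))
          have "hn 0 g \<le> hn 0 (?L1 (QN N \<phi>))"
            unfolding g_def by (intro PN_Hs(2) CL(2) Q\<phi>(1))
          also have "\<dots> \<le> CL * hn (real p) (QN N \<phi>)"
            by (rule CL(3)[OF Q\<phi>(1)])
          also have "\<dots> \<le> CL * (2 powr (real k - real p) * Np * hn (real k) \<phi>)"
            using CL(1) Q\<phi>(2) by (intro mult_left_mono) auto
          finally show "hn 0 g \<le> CL * (2 powr (real k - real p) * Np * hn (real k) \<phi>)" .
        qed
        have Ng: "Nop q k cc \<zeta> g \<in> Hs 0" "hn 0 (Nop q k cc \<zeta> g) \<le> P * Np"
        proof -
          have k: "Nop q k cc \<zeta> g \<in> Hs (0 + real k)" "hn (0 + real k) (Nop q k cc \<zeta> g) \<le> 1 / c * hn 0 g"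
            by (rule Nop_Hs[OF c g(1)])+
          show "Nop q k cc \<zeta> g \<in> Hs 0"
            using Hs_mono(1)[OF k(1), of 0] by simp
          have "hn 0 (Nop q k cc \<zeta> g) \<le> 1 / c * hn 0 g"
            using Hs_mono(2)[OF k(1), of 0] k(2) by simp
          also have "\<dots> \<le> 1 / c * (CL * (2 powr (real k - real p) * Np * hn (real k) \<phi>))"
            using g(2) c(1) by (intro mult_left_mono) auto
          also have "\<dots> = (P - 1) * Np"
            by (simp add: P_def)
          also have "\<dots> \<le> P * Np"
            using Np by (intro mult_right_mono) auto
          finally show "hn 0 (Nop q k cc \<zeta> g) \<le> P * Np" .
        qed
        have "hn 0 (IK q k cc p a \<zeta> z v) \<le> Np * (Q * hn 0 v + P)"
          unfolding IK_eq using Hs_diff(2)[OF Qv(1) Ng(1)] Qv(2) Ng(2) by (simp add: algebra_simps)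
        then have "hn 0 v * Np \<le> \<eta> * (Np * (Q * hn 0 v + P))"
          unfolding Np_def using \<eta>(1) by (intro order_trans[OF bound[OF z v]] mult_left_mono) auto
        then have "Np * hn 0 v \<le> Np * (\<eta> * Q * hn 0 v + \<eta> * P)"
          by (simp add: algebra_simps)
        then have "hn 0 v \<le> \<eta> * Q * hn 0 v + \<eta> * P"
          using Np by simp
        moreover have "\<eta> * Q * hn 0 v \<le> 1 / 2 * hn 0 v"
          using \<eta>(2) by (rule mult_right_mono) simp
        ultimately have "hn 0 v \<le> cmod (\<phi> m0) / 2"
          using \<eta>(3) by linarith
        moreover have "cmod (v m0) \<le> hn 0 v"
          using coeff_le_hn[OF PN_fixed_Hs[OF v], of m0 0] by simp
        ultimately show "cmod (y m0) \<le> cmod (\<phi> m0) / 2"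
          using m0F by (simp add: v_def PN_eq)
      qed
      then show False
        using m0 by simp
    qed
  qed
qed

text \<open>With \<open>c > 0\<close>, a product below a real number rules out the value infinity,
  hence \<open>T\<close> is bijective and the supremum dominates a genuine quotient.\<close>

lemma inv_opnorm_less_imp:
  assumes "inv_opnorm T V nV W nW * ereal c < ereal \<eta>" "0 < c"
    and "T (\<lambda>_. 0) = (\<lambda>_. 0)" "(\<lambda>_. 0) \<in> V" "u \<in> V" "u \<noteq> (\<lambda>_. 0)"
    and pos: "\<And>w. w \<in> W \<Longrightarrow> w \<noteq> (\<lambda>_. 0) \<Longrightarrow> 0 < nW w"
  shows "nV u * c \<le> \<eta> * nW (T u)"
proof -
  have bij: "bij_betw T V W"
    using assms(1,2) by (auto simp: inv_opnorm_def split: if_splits)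
  have "T u \<noteq> (\<lambda>_. 0)"
    using bij assms(3-6) by (metis bij_betw_imp_inj_on inj_onD)
  then have 0: "0 < nW (T u)"
    using bij assms(5) by (intro pos) (auto dest: bij_betwE)
  have "ereal (nV u / nW (T u)) \<le> inv_opnorm T V nV W nW"
    using bij assms(5,6) by (auto simp: inv_opnorm_def intro!: SUP_upper)
  then have "ereal (nV u / nW (T u)) * ereal c \<le> inv_opnorm T V nV W nW * ereal c"
    using assms(2) by (intro ereal_mult_right_mono) auto
  also note assms(1)
  finally have "nV u / nW (T u) * c < \<eta>"
    by simp
  then show ?thesis
    using 0 by (simp add: field_simps)
qed

theorem theoremt:
  fixes k p q ell :: nat and cc :: "nat \<Rightarrow> complex" and a :: "nat \<Rightarrow> fseq"
    and \<zeta> :: complex and cn :: "real \<Rightarrow> real"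
  assumes "k \<ge> 1" and "p < k" and "q \<le> k" and "ell \<ge> 1"
    and "cc k \<noteq> 0"
    and "\<forall>j \<le> p. a j \<in> Hs (real ell)"
    and "\<forall>r \<ge> 0. cn r > 0"
    and "\<forall>m::int. \<zeta> \<noteq> symb q k cc m"
  shows
   "(\<forall>s::real. min 0 (real p - real ell) \<le> s \<and> s \<le> max (2 * real p) (real p + real ell) \<longrightarrow>
      (\<exists>c::real. \<forall>\<epsilon>::real. \<epsilon> > 0 \<longrightarrow> (\<forall>N::nat. N \<ge> 1 \<and> real N > c * \<epsilon> powr (1 / (real p - real k)) \<longrightarrow>
         (\<forall>\<mu>. eig_trunc q k cc p a N \<mu> \<longrightarrow>
             \<mu> \<notin> pseudores (Lop q k cc p a) (Hs s) (hnorm cn s)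
                     (Hs (s - real k)) (hnorm cn (s - real k)) \<epsilon>)))) \<and>
    (\<forall>(lam::complex) (\<delta>::nat \<Rightarrow> real) (t::real).
      (\<exists>u \<in> Hs (real k). u \<noteq> (\<lambda>_. 0) \<and> Lop q k cc p a u = (\<lambda>m. lam * u m)) \<and>
      \<not> lam islimpt spec_op (Lop q k cc p a) (Hs (real k)) (hnorm cn (real k)) (Hs 0) (hnorm cn 0) \<and>
      Bseq \<delta> \<and> (\<forall>\<^sub>F N in sequentially. \<delta> N > 0) \<and>
      0 \<le> t \<and> t \<le> real k + real ell \<and>
      ((\<lambda>N. (SUP z \<in> sphere lam (\<delta> N). inv_opnorm (IK q k cc p a \<zeta> z) (Hs 0) (hnorm cn 0) (Hs 0) (hnorm cn 0))
             * ereal (real N powr (real p - real k))) \<longlongrightarrow> 0) sequentially \<and>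
      ((\<lambda>N. ereal (\<delta> N)
             * (SUP z \<in> sphere lam (\<delta> N). inv_opnorm (IK q k cc p a \<zeta> z) (Hs 0) (hnorm cn 0) (Hs 0) (hnorm cn 0))
             * (SUP z \<in> sphere lam (\<delta> N). inv_opnorm (IK q k cc p a \<zeta> z) (Hs t) (hnorm cn t) (Hs t) (hnorm cn t))
             * ereal (real N powr (- t) * (cmod lam + 1) ^ nat \<lceil>t / real (k - p)\<rceil>)) \<longlongrightarrow> 0) sequentially
      \<longrightarrow> (\<exists>N0::nat. \<forall>N > N0. \<exists>lamN. eig_trunc q k cc p a N lamN \<and> cmod (lam - lamN) \<le> \<delta> N))"
proof (intro conjI allI impI)
  have r: "1 \<le> real ell"
    using assms(4) by simp
  show "\<exists>c. \<forall>\<epsilon>>0. \<forall>N. 1 \<le> N \<and> c * \<epsilon> powr (1 / (real p - real k)) < real N \<longrightarrow>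
      (\<forall>\<mu>. eig_trunc q k cc p a N \<mu> \<longrightarrow>
        \<mu> \<notin> pseudores (Lop q k cc p a) (Hs s) (hnorm cn s) (Hs (s - real k)) (hnorm cn (s - real k)) \<epsilon>)" for s
    using eig_trunc_notin_pseudores[of p k q cc a "real ell" cn s] assms(2,3,5-7) r by blast
  fix lam and \<delta> :: "nat \<Rightarrow> real" and t
  let ?S = "\<lambda>N. SUP z \<in> sphere lam (\<delta> N). inv_opnorm (IK q k cc p a \<zeta> z) (Hs 0) (hnorm cn 0) (Hs 0) (hnorm cn 0)"
  assume "(\<exists>u \<in> Hs (real k). u \<noteq> (\<lambda>_. 0) \<and> Lop q k cc p a u = (\<lambda>m. lam * u m)) \<and>
      \<not> lam islimpt spec_op (Lop q k cc p a) (Hs (real k)) (hnorm cn (real k)) (Hs 0) (hnorm cn 0) \<and>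
      Bseq \<delta> \<and> (\<forall>\<^sub>F N in sequentially. \<delta> N > 0) \<and>
      0 \<le> t \<and> t \<le> real k + real ell \<and>
      ((\<lambda>N. ?S N * ereal (real N powr (real p - real k))) \<longlongrightarrow> 0) sequentially \<and>
      ((\<lambda>N. ereal (\<delta> N) * ?S N
             * (SUP z \<in> sphere lam (\<delta> N). inv_opnorm (IK q k cc p a \<zeta> z) (Hs t) (hnorm cn t) (Hs t) (hnorm cn t))
             * ereal (real N powr (- t) * (cmod lam + 1) ^ nat \<lceil>t / real (k - p)\<rceil>)) \<longlongrightarrow> 0) sequentially"
  then obtain \<phi> where \<phi>: "\<phi> \<in> Hs (real k)" "\<phi> \<noteq> (\<lambda>_. 0)" "Lop q k cc p a \<phi> = (\<lambda>m. lam * \<phi> m)"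
    and \<delta>: "\<forall>\<^sub>F N in sequentially. \<delta> N > 0"
    and lim: "(\<lambda>N. ?S N * ereal (real N powr (real p - real k))) \<longlonglongrightarrow> 0"
    by blast
  obtain \<eta> N0 where \<eta>: "0 < \<eta>" and near: "\<And>N d. N0 \<le> N \<Longrightarrow> 0 < d \<Longrightarrow>
      (\<And>z u. z \<in> sphere lam d \<Longrightarrow> PN N u = u \<Longrightarrow>
        hn 0 u * real N powr (real p - real k) \<le> \<eta> * hn 0 (IK q k cc p a \<zeta> z u)) \<Longrightarrow>
      \<exists>lamN. eig_trunc q k cc p a N lamN \<and> cmod (lam - lamN) \<le> d"
    using ex_eig_trunc_near[of p k q cc a "real ell" \<zeta> \<phi> lam] assms(2,3,5,6,8) r \<phi> by blast
  have cn0: "0 < sqrt (cn 0)"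
    using assms(7) by simp
  \<comment> \<open>The first limit is read off at the threshold \<open>\<eta>\<close>; the supremum
    over the circle then yields the resolvent bound at every \<open>z\<close> on it.\<close>
  have "\<forall>\<^sub>F N in sequentially. ?S N * ereal (real N powr (real p - real k)) < ereal \<eta>"
    using \<eta> by (intro order_tendstoD(2)[OF lim]) simp
  then have "\<forall>\<^sub>F N in sequentially. \<exists>lamN. eig_trunc q k cc p a N lamN \<and> cmod (lam - lamN) \<le> \<delta> N"
    using \<delta> eventually_ge_at_top[of N0] eventually_ge_at_top[of 1]
  proof eventually_elim
    case (elim N)
    show ?case
    proof (rule near[OF elim(3,2)])
      fix z u
      assume z: "z \<in> sphere lam (\<delta> N)" and u: "PN N u = u"
      let ?Np = "real N powr (real p - real k)"
      let ?I = "inv_opnorm (IK q k cc p a \<zeta> z) (Hs 0) (hnorm cn 0) (Hs 0) (hnorm cn 0)"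
      have "?I \<le> ?S N"
        using z by (intro SUP_upper)
      then have "?I * ereal ?Np \<le> ?S N * ereal ?Np"
        by (intro ereal_mult_right_mono) auto
      then have I: "?I * ereal ?Np < ereal \<eta>"
        using elim(1) by (rule le_less_trans)
      show "hn 0 u * ?Np \<le> \<eta> * hn 0 (IK q k cc p a \<zeta> z u)"
      proof (cases "u = (\<lambda>_. 0)")
        case True
        then show ?thesis
          using \<eta> by simp
      next
        case False
        have "hnorm cn 0 u * ?Np \<le> \<eta> * hnorm cn 0 (IK q k cc p a \<zeta> z u)"
        proof (rule inv_opnorm_less_imp[OF I])
          show "0 < hnorm cn 0 w" if "w \<in> Hs 0" "w \<noteq> (\<lambda>_. 0)" for w
            using hn_pos[OF that] cn0 by (simp add: hnorm_eq_hn)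
          show "IK q k cc p a \<zeta> z (\<lambda>_. 0) = (\<lambda>_. 0)"
            by (simp add: IK_def Nop_def Lop_def L0op_eq)
        qed (use elim(4) False PN_fixed_Hs[OF u] in auto)
        then have "sqrt (cn 0) * (hn 0 u * ?Np) \<le> sqrt (cn 0) * (\<eta> * hn 0 (IK q k cc p a \<zeta> z u))"
          by (simp add: hnorm_eq_hn mult_ac)
        then show ?thesis
          using cn0 by simp
      qed
    qed
  qed
  then obtain M where "\<forall>N\<ge>M. \<exists>lamN. eig_trunc q k cc p a N lamN \<and> cmod (lam - lamN) \<le> \<delta> N"
    by (auto simp: eventually_sequentially)
  then show "\<exists>N0. \<forall>N>N0. \<exists>lamN. eig_trunc q k cc p a N lamN \<and> cmod (lam - lamN) \<le> \<delta> N"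
    by (intro exI[of _ M]) auto
qed

end
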